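(* Let $p\ge 1$ be an integer, let $a_1,\ldots,a_{p+1},b_1,\ldots,b_p$ be complex numbers with no $a_j$ equal to a nonpositive integer, and put $s_p=b_1+\cdots+b_p-a_1-a_2-\cdots-a_{p+1}$. Suppose $\Re(a_j)>0$ for $j=3,\ldots,p+1$. If $s_p$ is equal to $2$, then the infinite series over $k$ below converges and $$\sum_{l=0}^{m-1}\frac{\Gamma(a_1+l)\Gamma(a_2+l)\cdots\Gamma(a_{p+1}+l)}{\Gamma(b_1+l)\cdots\Gamma(b_p+l)\Gamma(1+l)}=\frac{1}{(a_1)_2(a_2)_2}\sum_{k=0}^\infty\frac{(2)_k}{(a_1+2)_k(a_2+2)_k}A_k^{(p)}-\tfrac12[(m-1)(m-2)]^{-1}+O(m^{-3})$$ as $m\to\infty$ through the positive integers.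
   Context: $(x)_n=x(x+1)\cdots(x+n-1)=\Gamma(x+n)/\Gamma(x)$ is the Pochhammer symbol, $(x)_0=1$. The coefficients $A_k^{(p)}=A_k^{(p)}(a_3,\ldots,a_{p+1};b_1,\ldots,b_p)$, $k=0,1,2,\ldots$, are defined recursively in $p$: $A_0^{(1)}=1$ and $A_k^{(1)}=0$ for $k>0$; for $p\ge2$, $$A_k^{(p)}(a_3,\ldots,a_{p+1};b_1,\ldots,b_p)=\sum_{j=0}^{k}\frac{\bigl(\sum_{i=2}^{p}b_i-\sum_{i=3}^{p+1}a_i+j\bigr)_{k-j}\,(b_1-a_3)_{k-j}}{(k-j)!}\,A_j^{(p-1)}(a_4,\ldots,a_{p+1};b_2,\ldots,b_p).$$ For example $A_k^{(2)}=(b_2-a_3)_k(b_1-a_3)_k/k!$ and $A_k^{(3)}=\sum_{j=0}^k\frac{(b_3+b_2-a_4-a_3+j)_{k-j}(b_1-a_3)_{k-j}(b_3-a_4)_j(b_2-a_4)_j}{(k-j)!\,j!}$. The parameters are fixed and $m\to\infty$. $1/\Gamma$ is regarded as an entire function (zero at nonpositive integers). *)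

theory Defs
  imports "HOL-Analysis.Analysis" "HOL-Library.Landau_Symbols"
begin

text \<open>
  The parameters are infinite families \<open>a\<close>, \<open>b\<close> read at the original 1-based indices:
  \<open>A_coeff p a b k\<close> depends only on \<open>a 3, \<dots>, a (p + 1)\<close> and \<open>b 1, \<dots>, b p\<close>.  The recursive
  call drops \<open>a 3\<close> and \<open>b 1\<close>, so both families are shifted by one.
  The value for \<open>p = 0\<close> is left unspecified.
\<close>
fun A_coeff :: "nat \<Rightarrow> (nat \<Rightarrow> complex) \<Rightarrow> (nat \<Rightarrow> complex) \<Rightarrow> nat \<Rightarrow> complex" where
  "A_coeff (Suc 0) a b k = (if k = 0 then 1 else 0)"
| "A_coeff (Suc (Suc n)) a b k =
     (\<Sum>j=0..k.
        pochhammer ((\<Sum>i=2..n + 2. b i) - (\<Sum>i=3..n + 3. a i) + of_nat j) (k - j)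
        * pochhammer (b 1 - a 3) (k - j) / fact (k - j)
        * A_coeff (Suc n) (\<lambda>i. a (Suc i)) (\<lambda>i. b (Suc i)) j)"

lemma A_coeff_2:
  "A_coeff 2 a b k = pochhammer (b 2 - a 3) k * pochhammer (b 1 - a 3) k / fact k"
proof -
  have "A_coeff 2 a b k = (\<Sum>j=0..k.
        pochhammer ((\<Sum>i=2..2. b i) - (\<Sum>i=3..3. a i) + of_nat j) (k - j)
        * pochhammer (b 1 - a 3) (k - j) / fact (k - j) * (if j = 0 then 1 else 0))"
    using A_coeff.simps(2)[of 0 a b k] by (simp add: numeral_eq_Suc)
  also have "\<dots> = (\<Sum>j=0..k. if j = 0 then
      pochhammer (b 2 - a 3) k * pochhammer (b 1 - a 3) k / fact k else 0)"
    by (intro sum.cong) auto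
  finally show ?thesis by simp
qed

lemma A_coeff_3:
  "A_coeff 3 a b k =
     (\<Sum>j=0..k. pochhammer (b 3 + b 2 - a 4 - a 3 + of_nat j) (k - j)
        * pochhammer (b 1 - a 3) (k - j) * pochhammer (b 3 - a 4) j * pochhammer (b 2 - a 4) j
        / (fact (k - j) * fact j))"
proof -
  have eq: "A_coeff 3 a b k = (\<Sum>j=0..k.
        pochhammer ((\<Sum>i=2..3. b i) - (\<Sum>i=3..4. a i) + of_nat j) (k - j)
        * pochhammer (b 1 - a 3) (k - j) / fact (k - j)
        * A_coeff 2 (\<lambda>i. a (Suc i)) (\<lambda>i. b (Suc i)) j)"
    using A_coeff.simps(2)[of 1 a b k] by (simp add: numeral_eq_Suc del: A_coeff.simps)
  have "(\<Sum>i=2..3. b i) = b 2 + b 3" "(\<Sum>i=3..4. a i) = a 3 + a 4"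
    by (simp_all add: numeral_eq_Suc)
  then show ?thesis
    unfolding eq A_coeff_2 by (intro sum.cong) (simp_all add: algebra_simps flip: numeral_2_eq_2)
qed

end

theory Submission
  imports Defs "HOL-Real_Asymp.Real_Asymp"
begin

text \<open>
  Two facts are combined.  First, the terms of the series are \<open>1/l^3 + O(l^{-4})\<close>
  (\<open>hypergeom_term_asymp\<close>), and \<open>1/(l(l-1)(l-2))\<close> is the difference of consecutive values of
  \<open>1/(2(l-1)(l-2))\<close>.  So the partial sums corrected by \<open>1/(2(m-1)(m-2))\<close> have increments
  \<open>O(m^{-4})\<close> and approach the sum of the full series with error \<open>O(m^{-3})\<close>.

  Second, the sum of the full series is the stated series in the \<open>A_k\<close> (\<open>hypergeom_sum\<close>).  With
  \<open>\<sigma> = b_1 + \<dots> + b_p - a_3 - \<dots> - a_{p+1}\<close>, the reason is the inverse factorial expansion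
  \<open>\<Gamma>(a_3+l) \<dots> \<Gamma>(a_{p+1}+l) / (\<Gamma>(b_1+l) \<dots> \<Gamma>(b_p+l)) = \<Sum>_k A_k / \<Gamma>(\<sigma>+l+k)\<close>
  (\<open>gamma_quotient_inverse_factorial_series\<close>).  Multiplying by \<open>\<Gamma>(a_1+l) \<Gamma>(a_2+l) / l!\<close> and summing
  over \<open>l\<close> first turns every \<open>k\<close>-th term into a Gauss series \<open>2F1(a_1, a_2; \<sigma>+k; 1)\<close>, whose value
  (\<open>gauss_summation\<close>) is the \<open>k\<close>-th term of the claimed sum.

  The expansion is proved by induction on \<open>p\<close>: multiplying an inverse factorial series by
  \<open>\<Gamma>(a_3+l) / \<Gamma>(b_1+l)\<close> and expanding each product by Gauss's theorem yields exactly the recursion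
  of the \<open>A_k\<close>.  The rearrangement behind this is absolutely convergent if
  \<open>Re b_1 > Re a_3\<close>, but in general not otherwise, because the sum that defines \<open>A_k\<close> can then
  be much smaller than its terms.  The remaining parameters are reached by descent.  The trivial identity \<open>b_1 + l = (b_p - 1 + l) + (b_1 - b_p + 1)\<close> has a
  counterpart for the coefficients (\<open>A_coeff_exchange\<close>), which expresses the expansion at
  \<open>(b_1, b_p)\<close> through those at \<open>(b_1 + 1, b_p - 1)\<close> and \<open>(b_1 + 1, b_p)\<close>.  Both have the larger first
  parameter, and no condition restricts \<open>b_p\<close>, so finitely many such steps suffice.
\<close>

section \<open>Rates of convergence and the asymptotics of the Gamma function\<close>

text \<open>
  The increments are dominated by those of a multiple of \<open>1 / n ^ q\<close>, which telescope; letting the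
  upper end of the telescoped sum tend to infinity bounds the distance to the limit.
\<close>
lemma bigo_of_increments:
  fixes x :: "nat \<Rightarrow> complex"
  assumes lim: "x \<longlonglongrightarrow> L" and q: "q \<ge> 1"
    and inc: "(\<lambda>n. x (Suc n) - x n) \<in> O(\<lambda>n. 1 / of_nat n ^ Suc q)"
  shows "(\<lambda>n. x n - L) \<in> O(\<lambda>n. 1 / of_nat n ^ q)"
proof -
  obtain C where C: "C > 0"
    and ev: "eventually (\<lambda>n. norm (x (Suc n) - x n) \<le> C * norm (1 / (of_nat n :: complex) ^ Suc q)) at_top"
    using inc by (elim landau_o.bigE)
  then obtain N0 where N0: "\<And>n. n \<ge> N0 \<Longrightarrow> norm (x (Suc n) - x n) \<le> C * norm (1 / (of_nat n :: complex) ^ Suc q)"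
    unfolding eventually_at_top_linorder by blast
  define N where "N = max N0 1"
  \<comment> \<open>the factor \<open>2 ^ q\<close> pays for replacing \<open>n + 1\<close> by \<open>2 n\<close> in the telescoping differences of \<open>y\<close>\<close>
  define D where "D = C * 2 ^ q"
  define y where "y n = 1 / real n ^ q" for n
  have step: "norm (x (Suc n) - x n) \<le> D * (y n - y (Suc n))" if n: "n \<ge> N" for n
  proof -
    have n1: "n \<ge> 1" "n \<ge> N0" using n by (auto simp: N_def)
    have "real n * real n ^ q + real n ^ q \<le> real n * real (Suc n) ^ q"
    proof -
      obtain r where r: "q = Suc r" using q by (cases q) auto
      have "real (Suc n) * real n ^ r \<le> real (Suc n) * real (Suc n) ^ r"
        by (intro mult_left_mono power_mono) auto
      hence "real n * (real (Suc n) * real n ^ r) \<le> real n * (real (Suc n) * real (Suc n) ^ r)"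
        by (intro mult_left_mono) auto
      thus ?thesis by (simp add: r algebra_simps)
    qed
    hence "1 / (real n * real (Suc n) ^ q) \<le> y n - y (Suc n)"
      using n1 by (simp add: y_def field_simps)
    moreover have "1 / (2 ^ q * real n ^ Suc q) \<le> 1 / (real n * real (Suc n) ^ q)"
    proof -
      have "real (Suc n) ^ q \<le> (2 * real n) ^ q" using n1 by (intro power_mono) auto
      thus ?thesis using n1 by (intro divide_left_mono) (auto simp: power_mult_distrib)
    qed
    ultimately have "1 / (2 ^ q * real n ^ Suc q) \<le> y n - y (Suc n)"
      by linarith
    hence "2 ^ q * (1 / (2 ^ q * real n ^ Suc q)) \<le> 2 ^ q * (y n - y (Suc n))"
      by (intro mult_left_mono) auto
    hence "1 / real n ^ Suc q \<le> 2 ^ q * (y n - y (Suc n))" by simp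
    hence "C * (1 / real n ^ Suc q) \<le> D * (y n - y (Suc n))"
      using C unfolding D_def by (metis mult.assoc mult_le_cancel_left_pos)
    thus ?thesis using N0[OF n1(2)] by (simp add: norm_divide norm_power norm_mult)
  qed
  have tele: "norm (x (n + k) - x n) \<le> D * (y n - y (n + k))" if n: "n \<ge> N" for n k
  proof (induction k)
    case (Suc k)
    have "norm (x (n + Suc k) - x n) \<le> norm (x (Suc (n + k)) - x (n + k)) + norm (x (n + k) - x n)"
      using norm_triangle_ineq[of "x (Suc (n + k)) - x (n + k)" "x (n + k) - x n"] by simp
    also have "\<dots> \<le> D * (y (n + k) - y (Suc (n + k))) + D * (y n - y (n + k))"
      using step[of "n + k"] Suc n by (intro add_mono) auto
    finally show ?case by (simp add: algebra_simps)
  qed auto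
  have "norm (x n - L) \<le> D * norm (1 / (of_nat n :: complex) ^ q)" if n: "n \<ge> N" for n
  proof -
    have "(\<lambda>k. norm (x (k + n) - x n)) \<longlonglongrightarrow> norm (L - x n)"
      by (intro tendsto_intros LIMSEQ_ignore_initial_segment lim)
    moreover have "norm (x (k + n) - x n) \<le> D * y n" for k
    proof -
      have "D * (y n - y (n + k)) \<le> D * y n"
        using C by (intro mult_left_mono) (auto simp: D_def y_def)
      thus ?thesis using tele[OF n, of k] by (simp add: add.commute)
    qed
    ultimately have "norm (L - x n) \<le> D * y n"
      by (intro tendsto_upperbound[of "\<lambda>k. norm (x (k + n) - x n)"]) auto
    thus ?thesis by (simp add: y_def norm_divide norm_power norm_minus_commute)
  qed
  thus ?thesis by (intro landau_o.bigI[of D]) (use C in \<open>auto simp: D_def eventually_at_top_linorder\<close>)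
qed

text \<open>
  The ratio of \<open>\<Gamma>(n) n^z\<close> to its asymptotic equivalent \<open>\<Gamma>(z + n)\<close>, written with the entire
  function \<open>1/\<Gamma>\<close> so that it makes sense for every \<open>z\<close>.
\<close>
definition rGamma_ratio :: "complex \<Rightarrow> nat \<Rightarrow> complex" where
  "rGamma_ratio z n = rGamma (z + of_nat n) * Gamma (of_nat n) * of_nat n powr z"

lemma rGamma_ratio_plus1:
  assumes "n > 0"
  shows "rGamma_ratio z n = (z + of_nat n) / of_nat n * rGamma_ratio (z + 1) n"
  using assms rGamma_plus1[of "z + of_nat n"]
  by (simp add: rGamma_ratio_def powr_add field_simps)

text \<open>
  Away from the poles this is Euler's limit for \<open>\<Gamma>(z)\<close>; the nonpositive integers are reached from
  \<open>1\<close> by stepping down with \<open>rGamma_ratio_plus1\<close>.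
\<close>
lemma rGamma_ratio_tendsto_1: "rGamma_ratio z \<longlonglongrightarrow> 1"
proof -
  have step: "rGamma_ratio z \<longlonglongrightarrow> 1" if "rGamma_ratio (z + 1) \<longlonglongrightarrow> 1" for z
  proof (rule Lim_transform_eventually)
    have "(\<lambda>n. z / of_nat n + 1) \<longlonglongrightarrow> 0 + 1"
      by (intro tendsto_add tendsto_const tendsto_divide_0[OF tendsto_const] tendsto_of_nat)
    hence "(\<lambda>n. (z / of_nat n + 1) * rGamma_ratio (z + 1) n) \<longlonglongrightarrow> (0 + 1) * 1"
      using that by (intro tendsto_mult)
    thus "(\<lambda>n. (z / of_nat n + 1) * rGamma_ratio (z + 1) n) \<longlonglongrightarrow> 1" by simp
    show "\<forall>\<^sub>F n in sequentially. (z / of_nat n + 1) * rGamma_ratio (z + 1) n = rGamma_ratio z n"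
      using eventually_gt_at_top[of 0]
      by eventually_elim (simp add: rGamma_ratio_plus1[of _ z] field_simps)
  qed
  have reg: "rGamma_ratio z \<longlonglongrightarrow> 1" if z: "z \<notin> \<int>\<^sub>\<le>\<^sub>0" for z
  proof (rule Lim_transform_eventually)
    have "(\<lambda>n. rGamma z * Gamma_series' z n) \<longlonglongrightarrow> rGamma z * Gamma z"
      by (intro tendsto_mult tendsto_const Gamma_series'_LIMSEQ)
    thus "(\<lambda>n. rGamma z * Gamma_series' z n) \<longlonglongrightarrow> 1"
      using z by (simp add: rGamma_inverse_Gamma Gamma_eq_zero_iff)
    show "\<forall>\<^sub>F n in sequentially. rGamma z * Gamma_series' z n = rGamma_ratio z n"
      using eventually_gt_at_top[of 0]
    proof eventually_elim
      case (elim n)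
      then obtain k where n: "n = Suc k" by (cases n) auto
      have "Gamma (of_nat n :: complex) = fact (n - 1)"
        using Gamma_fact[of k, where 'a = complex] by (simp add: n add.commute)
      moreover have "pochhammer z n \<noteq> 0" using z by (auto dest: pochhammer_eq_0_imp_nonpos_Int)
      moreover have "(of_nat n :: complex) powr z = exp (z * of_real (ln (real n)))"
        using elim by (simp add: powr_def Ln_of_nat)
      ultimately show ?case using pochhammer_rGamma[of z n]
        by (simp add: rGamma_ratio_def Gamma_series'_def field_simps)
    qed
  qed
  show ?thesis
  proof (cases "z \<in> \<int>\<^sub>\<le>\<^sub>0")
    case True
    have "rGamma_ratio (1 - of_nat k) \<longlonglongrightarrow> 1" for k
    proof (induction k)
      case 0
      show ?case by (rule reg) auto
    next
      case (Suc k)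
      have "1 - of_nat (Suc k) + 1 = (1 - of_nat k :: complex)" by simp
      with Suc show ?case using step[of "1 - of_nat (Suc k)"] by simp
    qed
    moreover obtain k where "z = - of_nat k"
      using True by (elim nonpos_Ints_cases')
    hence "z = 1 - of_nat (Suc k)" by simp
    ultimately show ?thesis by (simp only:)
  qed (rule reg)
qed

text \<open>
  The factor \<open>(1 + z x) (1 + x)^{-z}\<close> has no linear term in \<open>x\<close>.  With \<open>x = 1/n\<close> it is the quotient
  of consecutive values of \<open>rGamma_ratio z\<close>.
\<close>
lemma norm_one_plus_mult_powr_le:
  fixes z :: complex and x :: real
  assumes "0 \<le> x" "x \<le> 1"
  shows "norm ((1 + z * x) * exp (- z * ln (1 + x)) - 1)
           \<le> (norm z ^ 2 * exp (norm z) + norm z) * exp (norm z) * x ^ 2"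
proof -
  define w where "w = z * ln (1 + x)"
  have ln: "0 \<le> ln (1 + x)" "ln (1 + x) \<le> x" using assms by (auto simp: ln_add_one_self_le_self)
  have w: "norm w \<le> norm z * x" using ln by (simp add: w_def norm_mult mult_left_mono)
  also have "\<dots> \<le> norm z * 1" using assms by (intro mult_left_mono) auto
  finally have w': "norm w \<le> norm z" by simp
  have "norm (exp w - (\<Sum>k\<le>1. w ^ k / fact k)) \<le> exp \<bar>Re w\<bar> * norm w ^ Suc 1 / fact 1"
    by (rule Taylor_exp)
  hence e1: "norm (exp w - 1 - w) \<le> exp \<bar>Re w\<bar> * norm w ^ 2"
    by (simp add: algebra_simps power2_eq_square)
  also have "\<dots> \<le> exp (norm z) * (norm z * x) ^ 2"
    using w w' abs_Re_le_cmod[of w] by (intro mult_mono power_mono) auto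
  finally have e2: "norm (1 + w - exp w) \<le> exp (norm z) * (norm z * x) ^ 2"
    by (simp add: norm_minus_commute algebra_simps)
  have "\<bar>ln (1 + x) - x\<bar> \<le> x ^ 2" using assms by (intro abs_ln_one_plus_x_minus_x_bound_nonneg) auto
  hence e3: "norm (z * (x - ln (1 + x))) \<le> norm z * x ^ 2"
    by (simp add: norm_mult mult_left_mono abs_minus_commute flip: of_real_diff)
  have "(1 + z * x) * exp (- z * ln (1 + x)) - 1 = exp (- w) * ((1 + w - exp w) + z * (x - ln (1 + x)))"
    by (simp add: w_def algebra_simps flip: exp_add)
  also have "norm \<dots> \<le> exp (norm z) * (exp (norm z) * (norm z * x) ^ 2 + norm z * x ^ 2)"
    unfolding norm_mult[of "exp (- w)"]
  proof (intro mult_mono order.trans[OF norm_triangle_ineq] add_mono e2 e3)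
    show "norm (exp (- w)) \<le> exp (norm z)"
      using w' abs_Re_le_cmod[of w] by simp
  qed auto
  also have "\<dots> = (norm z ^ 2 * exp (norm z) + norm z) * exp (norm z) * x ^ 2"
    by (simp add: algebra_simps power_mult_distrib)
  finally show ?thesis .
qed

text \<open>
  A first-order Stirling formula with error term, from the recurrence alone: consecutive values
  differ by \<open>O(n^{-2})\<close>, and the limit is known.
\<close>
lemma rGamma_ratio_bigo: "(\<lambda>n. rGamma_ratio z n - 1) \<in> O(\<lambda>n. 1 / of_nat n)"
proof -
  define C where "C = (norm z ^ 2 * exp (norm z) + norm z) * exp (norm z)"
  define \<epsilon> where "\<epsilon> n = (1 + z * (1 / real n)) * exp (- z * ln (1 + 1 / real n)) - 1" for n :: nat
  have rec: "rGamma_ratio z n - rGamma_ratio z (Suc n) = rGamma_ratio z (Suc n) * \<epsilon> n" if n: "n > 0" for n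
  proof -
    have "Gamma (of_nat (Suc n) :: complex) = of_nat n * Gamma (of_nat n)"
      using Gamma_plus1[of "of_nat n :: complex"] n
      by (simp add: add.commute of_nat_in_nonpos_Ints_iff)
    moreover have "rGamma (z + of_nat n) = (z + of_nat n) * rGamma (z + of_nat (Suc n))"
      using rGamma_plus1[of "z + of_nat n"] by (simp add: add_ac)
    moreover have "(of_nat n :: complex) powr z = of_nat (Suc n) powr z * exp (- z * ln (1 + 1 / real n))"
    proof -
      have "1 + 1 / real n = real (Suc n) / real n" using n by (simp add: field_simps)
      hence "ln (1 + 1 / real n) = ln (real (Suc n)) - ln (real n)"
        using n by (simp add: ln_div)
      thus ?thesis using n
        by (simp add: powr_def Ln_of_nat ring_distribs del: of_nat_Suc flip: exp_add)
    qed
    ultimately show ?thesis using n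
      by (simp add: rGamma_ratio_def \<epsilon>_def divide_simps del: of_nat_Suc) (simp add: algebra_simps)
  qed
  have "\<epsilon> \<in> O(\<lambda>n. 1 / of_nat n ^ Suc 1)"
  proof (rule landau_o.bigI[of "C + 1"])
    show "\<forall>\<^sub>F n in sequentially. norm (\<epsilon> n) \<le> (C + 1) * norm (1 / (of_nat n :: complex) ^ Suc 1)"
      using eventually_gt_at_top[of 0]
    proof eventually_elim
      case (elim n)
      have "norm (\<epsilon> n) \<le> C * (1 / real n) ^ 2"
        unfolding \<epsilon>_def C_def using elim by (intro norm_one_plus_mult_powr_le) auto
      also have "\<dots> \<le> (C + 1) * (1 / real n) ^ 2" by (intro mult_right_mono) auto
      finally show ?case by (simp add: norm_divide norm_power power2_eq_square norm_mult)
    qed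
    show "C + 1 > 0" unfolding C_def by (intro add_nonneg_pos) auto
  qed
  moreover have "(\<lambda>n. rGamma_ratio z (Suc n)) \<in> O(\<lambda>_. 1)"
    by (rule bigoI_tendsto[of _ _ 1]) (use filterlim_sequentially_Suc rGamma_ratio_tendsto_1 in auto)
  ultimately have "(\<lambda>n. rGamma_ratio z (Suc n) * \<epsilon> n) \<in> O(\<lambda>n. 1 * (1 / of_nat n ^ Suc 1))"
    by (intro landau_o.big.mult)
  also have "?this \<longleftrightarrow> (\<lambda>n. rGamma_ratio z n - rGamma_ratio z (Suc n)) \<in> O(\<lambda>n. 1 * (1 / of_nat n ^ Suc 1))"
    by (intro landau_o.big.in_cong eventually_mono[OF eventually_gt_at_top[of 0]]) (simp add: rec)
  also have "\<dots> \<longleftrightarrow> (\<lambda>n. rGamma_ratio z (Suc n) - rGamma_ratio z n) \<in> O(\<lambda>n. 1 / of_nat n ^ Suc 1)"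
    by (subst landau_o.big.uminus_in_iff[symmetric]) simp
  finally show ?thesis
    using bigo_of_increments[OF rGamma_ratio_tendsto_1[of z], of 1] by simp
qed

section \<open>Gauss's summation theorem\<close>

lemma Re_pos_imp_notin_nonpos_Ints: "Re z > 0 \<Longrightarrow> z \<notin> \<int>\<^sub>\<le>\<^sub>0"
  by (auto elim!: nonpos_Ints_cases')

lemma pochhammer_times_rGamma_ratio:
  "pochhammer z n * rGamma_ratio z n = rGamma z * Gamma (of_nat n) * of_nat n powr z"
  using pochhammer_rGamma[of z n] by (simp add: rGamma_ratio_def)

lemma rGamma_ratio_nonzero: "eventually (\<lambda>n. rGamma_ratio z n \<noteq> 0) sequentially"
  by (rule tendsto_imp_eventually_ne[OF rGamma_ratio_tendsto_1]) auto

text \<open>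
  Moving the base point to the right moves every factor away from the origin.
\<close>
lemma norm_pochhammer_mono:
  assumes "Re z \<ge> 0"
  shows "norm (pochhammer z n) \<le> norm (pochhammer (z + of_nat k) n)"
proof -
  have "norm (z + of_nat i) \<le> norm (z + of_nat k + of_nat i)" for i
  proof -
    have "\<bar>Re z + real i\<bar> \<le> \<bar>Re z + real k + real i\<bar>" using assms by simp
    hence "(Re z + real i)\<^sup>2 \<le> (Re z + real k + real i)\<^sup>2" by (simp only: abs_le_square_iff)
    thus ?thesis by (simp add: cmod_def)
  qed
  thus ?thesis unfolding pochhammer_prod prod_norm[symmetric] by (intro prod_mono) auto
qed

text \<open>
  The terms of the regularised series \<open>2F1(a, b; c; 1) / \<Gamma>(c)\<close>, which is meaningful for all \<open>c\<close>.
\<close>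
definition gauss_term :: "complex \<Rightarrow> complex \<Rightarrow> complex \<Rightarrow> nat \<Rightarrow> complex" where
  "gauss_term a b c n = pochhammer a n * pochhammer b n / fact n * rGamma (c + of_nat n)"

lemma gauss_term_eventually_eq:
  "eventually (\<lambda>n. gauss_term a b c n = rGamma a * rGamma b *
     (rGamma_ratio c n / (rGamma_ratio a n * rGamma_ratio b n)) * of_nat n powr (a + b - c - 1)) sequentially"
  using rGamma_ratio_nonzero[of a] rGamma_ratio_nonzero[of b] eventually_gt_at_top[of 0]
proof eventually_elim
  case (elim n)
  have nz: "(of_nat n :: complex) \<noteq> 0" "(of_nat n :: complex) powr c \<noteq> 0" using elim by auto
  have G: "Gamma (of_nat n :: complex) \<noteq> 0"
    using elim by (simp add: Gamma_eq_zero_iff of_nat_in_nonpos_Ints_iff)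
  have F: "(fact n :: complex) = of_nat n * Gamma (of_nat n)"
    using elim Gamma_fact[of n, where 'a = complex] Gamma_plus1[of "of_nat n :: complex"]
    by (simp add: add.commute of_nat_in_nonpos_Ints_iff)
  have "of_nat n powr (a + b - c - 1) = (of_nat n powr a * of_nat n powr b) / (of_nat n powr c * of_nat n :: complex)"
    using nz by (simp add: powr_diff powr_add)
  moreover have "pochhammer z n = rGamma z * Gamma (of_nat n) * of_nat n powr z / rGamma_ratio z n"
    if "rGamma_ratio z n \<noteq> 0" for z
    using that pochhammer_times_rGamma_ratio[of z n] by (simp add: field_simps)
  moreover have "rGamma (c + of_nat n) = rGamma_ratio c n / (Gamma (of_nat n) * of_nat n powr c)"
    using nz G by (simp add: rGamma_ratio_def)
  ultimately show ?case using elim nz G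
    by (simp add: gauss_term_def F mult_ac)
qed

lemma gauss_term_eventually_le:
  "\<exists>C\<ge>0. eventually (\<lambda>n. norm (gauss_term a b c n) \<le> C * real n powr (Re (a + b - c) - 1)) sequentially"
proof -
  have "(\<lambda>n. rGamma_ratio c n / (rGamma_ratio a n * rGamma_ratio b n)) \<longlonglongrightarrow> 1 / (1 * 1)"
    by (intro tendsto_intros rGamma_ratio_tendsto_1) auto
  hence "(\<lambda>n. norm (rGamma_ratio c n / (rGamma_ratio a n * rGamma_ratio b n))) \<longlonglongrightarrow> norm (1 :: complex)"
    by (intro tendsto_norm) simp
  hence "eventually (\<lambda>n. norm (rGamma_ratio c n / (rGamma_ratio a n * rGamma_ratio b n)) < 2) sequentially"
    by (rule order_tendstoD) simp
  hence "eventually (\<lambda>n. norm (gauss_term a b c n)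
      \<le> (norm (rGamma a * rGamma b) * 2) * real n powr (Re (a + b - c) - 1)) sequentially"
    using gauss_term_eventually_eq[of a b c] eventually_gt_at_top[of 0]
  proof eventually_elim
    case (elim n)
    have "norm ((of_nat n :: complex) powr (a + b - c - 1)) = real n powr (Re (a + b - c) - 1)"
      using elim norm_powr_real_powr[of "of_nat n :: complex" "a + b - c - 1"] by simp
    hence "norm (gauss_term a b c n) = norm (rGamma a * rGamma b) *
        norm (rGamma_ratio c n / (rGamma_ratio a n * rGamma_ratio b n)) * real n powr (Re (a + b - c) - 1)"
      using elim(2) by (simp only: norm_mult)
    also have "\<dots> \<le> norm (rGamma a * rGamma b) * 2 * real n powr (Re (a + b - c) - 1)"
      using elim(1) by (intro mult_right_mono mult_left_mono) auto
    finally show ?case .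
  qed
  thus ?thesis by (intro exI[of _ "norm (rGamma a * rGamma b) * 2"]) auto
qed

lemma summable_norm_gauss_term:
  assumes "Re (c - a - b) > 0"
  shows "summable (\<lambda>n. norm (gauss_term a b c n))"
proof -
  obtain C where C: "eventually (\<lambda>n. norm (gauss_term a b c n) \<le> C * real n powr (Re (a + b - c) - 1)) sequentially"
    using gauss_term_eventually_le by blast
  show ?thesis
  proof (rule summable_comparison_test_ev)
    show "eventually (\<lambda>n. norm (norm (gauss_term a b c n)) \<le> C * real n powr (Re (a + b - c) - 1)) sequentially"
      using C by (simp only: real_norm_def abs_norm_cancel)
    show "summable (\<lambda>n. C * real n powr (Re (a + b - c) - 1))"
      using assms by (intro summable_mult) (simp add: summable_real_powr_iff)
  qed
qed

lemma n_times_gauss_term_tendsto_0: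
  assumes "Re (c - a - b) > 0"
  shows "(\<lambda>n. of_nat n * gauss_term a b c n) \<longlonglongrightarrow> 0"
proof -
  obtain C where C: "eventually (\<lambda>n. norm (gauss_term a b c n) \<le> C * real n powr (Re (a + b - c) - 1)) sequentially"
    using gauss_term_eventually_le by blast
  have "eventually (\<lambda>n. norm (of_nat n * gauss_term a b c n) \<le> C * real n powr Re (a + b - c)) sequentially"
    using C eventually_gt_at_top[of 0]
  proof eventually_elim
    case (elim n)
    have "norm (of_nat n * gauss_term a b c n) \<le> real n * (C * real n powr (Re (a + b - c) - 1))"
      using elim by (simp add: norm_mult mult_left_mono)
    also have "\<dots> = C * real n powr Re (a + b - c)"
      using elim by (simp add: powr_diff)
    finally show ?case .
  qed
  moreover have "(\<lambda>n. C * real n powr Re (a + b - c)) \<longlonglongrightarrow> C * 0"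
    using assms by (intro tendsto_mult tendsto_const tendsto_neg_powr filterlim_real_sequentially) simp
  ultimately show ?thesis
    using Lim_null_comparison[of "\<lambda>n. of_nat n * gauss_term a b c n" "\<lambda>n. C * real n powr Re (a + b - c)"]
    unfolding mult_zero_right by blast
qed

text \<open>
  A telescoping form of the contiguous relation between \<open>c\<close> and \<open>c + 1\<close>; after division by the
  \<open>n\<close>-th term at \<open>c + 1\<close> it is a polynomial identity in \<open>n\<close>.
\<close>
lemma gauss_term_contiguous:
  "(c - a - b) * gauss_term a b c n - (c - a) * (c - b) * gauss_term a b (c + 1) n
     = of_nat n * gauss_term a b c n - of_nat (Suc n) * gauss_term a b c (Suc n)"
proof -
  define t where "t = gauss_term a b (c + 1) n"
  have r: "rGamma (c + of_nat n) = (c + of_nat n) * rGamma (c + 1 + of_nat n)"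
    using rGamma_plus1[of "c + of_nat n"] by (simp add: add_ac)
  have 1: "gauss_term a b c n = (c + of_nat n) * t"
    by (simp add: gauss_term_def t_def r)
  have "rGamma (c + of_nat (Suc n)) = rGamma (c + 1 + of_nat n)" by (simp add: add_ac)
  hence 2: "of_nat (Suc n) * gauss_term a b c (Suc n) = (a + of_nat n) * (b + of_nat n) * t"
    by (simp add: gauss_term_def t_def pochhammer_Suc field_simps del: of_nat_Suc)
  show ?thesis unfolding 1 2 t_def[symmetric] by (simp add: algebra_simps)
qed

lemma gauss_sum_contiguous:
  assumes "Re (c - a - b) > 0"
  shows "(c - a - b) * (\<Sum>n. gauss_term a b c n) = (c - a) * (c - b) * (\<Sum>n. gauss_term a b (c + 1) n)"
proof -
  have s1: "summable (gauss_term a b c)" and s2: "summable (gauss_term a b (c + 1))"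
    using assms by (auto intro!: summable_norm_cancel[OF summable_norm_gauss_term])
  have "(\<lambda>n. of_nat n * gauss_term a b c n - of_nat (Suc n) * gauss_term a b c (Suc n))
          sums (of_nat 0 * gauss_term a b c 0 - 0)"
    by (rule telescope_sums'[OF n_times_gauss_term_tendsto_0[OF assms]])
  hence "(\<lambda>n. (c - a - b) * gauss_term a b c n - (c - a) * (c - b) * gauss_term a b (c + 1) n) sums 0"
    by (simp add: gauss_term_contiguous)
  moreover have "(\<lambda>n. (c - a - b) * gauss_term a b c n - (c - a) * (c - b) * gauss_term a b (c + 1) n) sums
      ((c - a - b) * (\<Sum>n. gauss_term a b c n) - (c - a) * (c - b) * (\<Sum>n. gauss_term a b (c + 1) n))"
    by (intro sums_diff sums_mult summable_sums s1 s2)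
  ultimately show ?thesis using sums_unique2 by force
qed

lemma gauss_sum_shift:
  assumes "Re (c - a - b) > 0"
  shows "pochhammer (c - a - b) m * (\<Sum>n. gauss_term a b c n)
     = pochhammer (c - a) m * pochhammer (c - b) m * (\<Sum>n. gauss_term a b (c + of_nat m) n)"
proof (induction m)
  case (Suc m)
  define G where "G = (\<Sum>n. gauss_term a b (c + of_nat (Suc m)) n)"
  have "(c + of_nat m - a - b) * (\<Sum>n. gauss_term a b (c + of_nat m) n)
       = (c + of_nat m - a) * (c + of_nat m - b) * G"
    unfolding G_def using assms gauss_sum_contiguous[of "c + of_nat m" a b]
    by (simp add: add_ac)
  hence *: "(c - a - b + of_nat m) * (\<Sum>n. gauss_term a b (c + of_nat m) n)
       = (c - a + of_nat m) * (c - b + of_nat m) * G"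
    by (simp add: algebra_simps)
  have "pochhammer (c - a - b) (Suc m) * (\<Sum>n. gauss_term a b c n)
      = (c - a - b + of_nat m) * (pochhammer (c - a - b) m * (\<Sum>n. gauss_term a b c n))"
    by (simp add: pochhammer_Suc mult_ac)
  also have "\<dots> = pochhammer (c - a) m * pochhammer (c - b) m *
      ((c - a - b + of_nat m) * (\<Sum>n. gauss_term a b (c + of_nat m) n))"
    unfolding Suc by (simp only: mult_ac)
  also have "\<dots> = pochhammer (c - a) (Suc m) * pochhammer (c - b) (Suc m) * G"
    unfolding * by (simp add: pochhammer_Suc mult_ac)
  finally show ?case by (simp add: G_def)
qed simp

text \<open>
  Shifting \<open>c\<close> to the right costs at most a constant times \<open>1/\<Gamma>(c + k)\<close>, uniformly in \<open>n\<close>.  This supplies the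
  dominating series in the limit \<open>c \<rightarrow> \<infinity>\<close> and in the final interchange of sums.
\<close>
lemma norm_gauss_term_shift_le:
  assumes "Re c > 0"
  shows "norm (gauss_term a b (c + of_nat k) n)
           \<le> norm (rGamma (c + of_nat k)) * norm (Gamma c) * norm (gauss_term a b c n)"
proof -
  define P where "P = pochhammer a n * pochhammer b n / fact n"
  have nz: "pochhammer (c + of_nat k) n \<noteq> 0" "pochhammer c n \<noteq> 0" "Gamma c \<noteq> 0"
    using assms Re_pos_imp_notin_nonpos_Ints[of "c + of_nat k"] Re_pos_imp_notin_nonpos_Ints[of c]
    by (auto simp: Gamma_eq_zero_iff dest: pochhammer_eq_0_imp_nonpos_Int)
  have "gauss_term a b (c + of_nat k) n = P * (rGamma (c + of_nat k) / pochhammer (c + of_nat k) n)"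
    using pochhammer_rGamma[of "c + of_nat k" n] nz by (simp add: gauss_term_def P_def)
  also have "norm \<dots> = norm P * (norm (rGamma (c + of_nat k)) / norm (pochhammer (c + of_nat k) n))"
    by (simp only: norm_mult norm_divide)
  also have "\<dots> \<le> norm P * (norm (rGamma (c + of_nat k)) / norm (pochhammer c n))"
    using nz assms by (intro mult_left_mono divide_left_mono norm_pochhammer_mono) auto
  also have "\<dots> = norm (rGamma (c + of_nat k)) * norm (Gamma c) * norm (gauss_term a b c n)"
  proof -
    have "rGamma (c + of_nat n) = rGamma c / pochhammer c n"
      using nz pochhammer_rGamma[of c n] by (simp add: field_simps)
    thus ?thesis using nz
      by (simp add: P_def gauss_term_def norm_mult norm_divide rGamma_inverse_Gamma norm_inverse field_simps)
  qed
  finally show ?thesis .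
qed

text \<open>
  As \<open>c\<close> moves to infinity only the term with \<open>n = 0\<close> survives.
\<close>
lemma gauss_sum_asymp:
  "(\<lambda>m. Gamma (of_nat m) * of_nat m powr c * (\<Sum>n. gauss_term a b (c + of_nat m) n)) \<longlonglongrightarrow> 1"
proof -
  define f where "f n m = Gamma (of_nat m) * of_nat m powr c * gauss_term a b (c + of_nat m) n" for n m :: nat
  \<comment> \<open>far enough to the right for a positive real part and for convergence of the dominating series\<close>
  obtain m0 :: nat where m0: "real m0 > \<bar>Re c\<bar> + \<bar>Re (a + b - c)\<bar>"
    using reals_Archimedean2 by blast
  define c0 where "c0 = c + of_nat m0"
  have c0: "Re c0 > 0" using m0 by (simp add: c0_def)
  have c0': "Re (c0 - a - b) > 0" using m0 by (simp add: c0_def)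
  define M where "M n = 2 * norm (Gamma c0) * norm (gauss_term a b c0 n)" for n
  have ev: "eventually (\<lambda>m. norm (rGamma_ratio c m) < 2) sequentially"
    using tendsto_norm[OF rGamma_ratio_tendsto_1[of c]] by (rule order_tendstoD) simp
  have bnd: "norm (f n m) \<le> M n" if m: "m \<ge> m0" "norm (rGamma_ratio c m) < 2" for n m
  proof -
    obtain k where k: "m = m0 + k" using m(1) le_Suc_ex by blast
    have ck: "c + of_nat m = c0 + of_nat k" by (simp add: c0_def k)
    have "norm (f n m) = norm (Gamma (of_nat m :: complex) * of_nat m powr c) * norm (gauss_term a b (c0 + of_nat k) n)"
      by (simp only: f_def ck norm_mult)
    also have "\<dots> \<le> norm (Gamma (of_nat m :: complex) * of_nat m powr c) *
        (norm (rGamma (c0 + of_nat k)) * norm (Gamma c0) * norm (gauss_term a b c0 n))"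
      by (intro mult_left_mono norm_gauss_term_shift_le c0) auto
    also have "\<dots> = norm (rGamma_ratio c m) * (norm (Gamma c0) * norm (gauss_term a b c0 n))"
      by (simp add: rGamma_ratio_def ck norm_mult)
    also have "\<dots> \<le> 2 * (norm (Gamma c0) * norm (gauss_term a b c0 n))"
      using m(2) by (intro mult_right_mono) auto
    also have "\<dots> = M n" by (simp add: M_def)
    finally show ?thesis .
  qed
  have "((\<lambda>m. \<Sum>n. f n m) \<longlongrightarrow> (\<Sum>n. if n = 0 then 1 else 0)) sequentially"
  proof (rule tannerys_theorem[where M = M, THEN conjunct2, THEN conjunct2])
    fix n :: nat
    show "((\<lambda>m. f n m) \<longlongrightarrow> (if n = 0 then 1 else 0)) sequentially"
    proof (rule Lim_transform_eventually)
      have lim0: "pochhammer a n * pochhammer b n / fact n * (1 * 0 ^ n) = (if n = 0 then 1 else 0)"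
        by (cases n) auto
      have "(\<lambda>m. pochhammer a n * pochhammer b n / fact n * (rGamma_ratio (c + of_nat n) m * (1 / of_nat m) ^ n))
           \<longlonglongrightarrow> pochhammer a n * pochhammer b n / fact n * (1 * 0 ^ n)"
        by (intro tendsto_intros rGamma_ratio_tendsto_1 lim_1_over_n)
      thus "(\<lambda>m. pochhammer a n * pochhammer b n / fact n * (rGamma_ratio (c + of_nat n) m * (1 / of_nat m) ^ n))
           \<longlonglongrightarrow> (if n = 0 then 1 else 0)" by (simp only: lim0)
      show "\<forall>\<^sub>F m in sequentially. pochhammer a n * pochhammer b n / fact n *
           (rGamma_ratio (c + of_nat n) m * (1 / of_nat m) ^ n) = f n m"
        using eventually_gt_at_top[of 0]
        by eventually_elim
           (simp add: f_def gauss_term_def rGamma_ratio_def powr_add powr_nat' add_ac power_divide)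
    qed
    show "eventually (\<lambda>(k,n). norm (f k n) \<le> M k) (at_top \<times>\<^sub>F sequentially)"
      unfolding case_prod_beta
      by (rule eventually_mono[OF eventually_prodI[OF always_eventually eventually_conj[OF ev eventually_ge_at_top[of m0]]], of "\<lambda>_. True"])
         (use bnd in auto)
    show "summable M" unfolding M_def by (intro summable_mult summable_norm_gauss_term c0')
  qed simp
  also have "(\<Sum>n::nat. if n = 0 then 1 else 0 :: complex) = 1"
    using sums_If_finite_set[of "{0::nat}" "\<lambda>_. 1 :: complex"] by (simp add: sums_iff)
  finally have lim: "(\<lambda>m. \<Sum>n. f n m) \<longlonglongrightarrow> 1" .
  show ?thesis
  proof (rule Lim_transform_eventually[OF lim])
    show "\<forall>\<^sub>F m in sequentially. (\<Sum>n. f n m) =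
        Gamma (of_nat m) * of_nat m powr c * (\<Sum>n. gauss_term a b (c + of_nat m) n)"
      using eventually_ge_at_top[of m0]
    proof eventually_elim
      case (elim m)
      have "summable (gauss_term a b (c + of_nat m))"
        using m0 elim by (intro summable_norm_cancel[OF summable_norm_gauss_term]) auto
      thus ?case unfolding f_def by (rule suminf_mult)
    qed
  qed
qed

text \<open>
  The contiguous relation carries the sum from \<open>c\<close> to \<open>c + m\<close>; the sum at \<open>c + m\<close> and the Pochhammer
  factors that are picked up on the way have known asymptotics in \<open>m\<close>.
\<close>
theorem gauss_summation:
  assumes "Re (c - a - b) > 0"
  shows "gauss_term a b c sums (Gamma (c - a - b) * rGamma (c - a) * rGamma (c - b))"
proof -
  define G where "G = (\<Sum>n. gauss_term a b c n)"
  define s where "s = c - a - b"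
  define E where "E m = Gamma (of_nat m) * of_nat m powr c * (\<Sum>n. gauss_term a b (c + of_nat m) n)" for m
  have "(\<lambda>m. rGamma (c - a) * rGamma (c - b) * rGamma_ratio s m * E m) \<longlonglongrightarrow>
          rGamma (c - a) * rGamma (c - b) * 1 * 1"
    unfolding E_def by (intro tendsto_mult tendsto_const rGamma_ratio_tendsto_1 gauss_sum_asymp)
  moreover have "(\<lambda>m. rGamma (c - a) * rGamma (c - b) * rGamma_ratio s m * E m) \<longlonglongrightarrow> rGamma s * G"
  proof (rule Lim_transform_eventually)
    have "(\<lambda>m. rGamma s * G * rGamma_ratio (c - a) m * rGamma_ratio (c - b) m) \<longlonglongrightarrow> rGamma s * G * 1 * 1"
      by (intro tendsto_mult tendsto_const rGamma_ratio_tendsto_1)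
    thus "(\<lambda>m. rGamma s * G * rGamma_ratio (c - a) m * rGamma_ratio (c - b) m) \<longlonglongrightarrow> rGamma s * G"
      by simp
    show "\<forall>\<^sub>F m in sequentially. rGamma s * G * rGamma_ratio (c - a) m * rGamma_ratio (c - b) m =
             rGamma (c - a) * rGamma (c - b) * rGamma_ratio s m * E m"
      using eventually_gt_at_top[of 0]
    proof eventually_elim
      case (elim m)
      define g N Gm where "g = Gamma (of_nat m :: complex)" and "N = (of_nat m :: complex)"
        and "Gm = (\<Sum>n. gauss_term a b (c + of_nat m) n)"
      have nz: "g \<noteq> 0" "N powr s \<noteq> 0"
        using elim by (auto simp: g_def N_def Gamma_eq_zero_iff of_nat_in_nonpos_Ints_iff)
      have P: "pochhammer z m * rGamma_ratio z m = rGamma z * g * N powr z" for z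
        by (simp add: pochhammer_times_rGamma_ratio g_def N_def)
      have "N powr (c - a) * N powr (c - b) = N powr c * N powr s"
        by (simp add: s_def algebra_simps flip: powr_add)
      hence "(g * N powr s) * (rGamma (c - a) * rGamma (c - b) * rGamma_ratio s m * (g * N powr c * Gm))
          = (rGamma (c - a) * g * N powr (c - a)) * (rGamma (c - b) * g * N powr (c - b)) * rGamma_ratio s m * Gm"
        by algebra
      also have "\<dots> = (pochhammer (c - a) m * pochhammer (c - b) m * Gm)
                   * rGamma_ratio (c - a) m * rGamma_ratio (c - b) m * rGamma_ratio s m"
        unfolding P[symmetric] by (simp only: mult_ac)
      also have "pochhammer (c - a) m * pochhammer (c - b) m * Gm = pochhammer s m * G"
        using gauss_sum_shift[OF assms, of m] by (simp add: G_def Gm_def s_def)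
      also have "pochhammer s m * G * rGamma_ratio (c - a) m * rGamma_ratio (c - b) m * rGamma_ratio s m
           = (pochhammer s m * rGamma_ratio s m) * G * rGamma_ratio (c - a) m * rGamma_ratio (c - b) m"
        by (simp only: mult_ac)
      also have "\<dots> = (g * N powr s) * (rGamma s * G * rGamma_ratio (c - a) m * rGamma_ratio (c - b) m)"
        unfolding P by (simp only: mult_ac)
      finally show ?case using nz by (simp add: E_def g_def N_def Gm_def)
    qed
  qed
  ultimately have "rGamma s * G = rGamma (c - a) * rGamma (c - b)"
    using LIMSEQ_unique by fastforce
  moreover have "rGamma s \<noteq> 0"
    using assms Re_pos_imp_notin_nonpos_Ints[of s] by (simp add: s_def rGamma_eq_zero_iff)
  ultimately have "G = Gamma s * rGamma (c - a) * rGamma (c - b)"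
    by (simp add: rGamma_inverse_Gamma field_simps)
  moreover have "gauss_term a b c sums G"
    unfolding G_def using assms by (intro summable_sums summable_norm_cancel[OF summable_norm_gauss_term])
  ultimately show ?thesis by (simp add: s_def)
qed

section \<open>Interchanging double series\<close>

lemma iterated_infsum:
  fixes F :: "nat \<times> nat \<Rightarrow> complex"
  assumes "(\<lambda>x. norm (F x)) summable_on Sigma UNIV B"
  shows "summable (\<lambda>k. norm (infsum (\<lambda>j. F (k, j)) (B k)))"
    and "(\<lambda>k. infsum (\<lambda>j. F (k, j)) (B k)) sums infsum F (Sigma UNIV B)"
proof -
  have 1: "(\<lambda>j. norm (F (k, j))) summable_on B k" for k
    using assms unfolding Infinite_Sum.abs_summable_on_Sigma_iff by auto
  have 2: "(\<lambda>k. norm (infsum (\<lambda>j. norm (F (k, j))) (B k))) summable_on UNIV"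
    using assms unfolding Infinite_Sum.abs_summable_on_Sigma_iff by auto
  have 3: "summable (\<lambda>k. infsum (\<lambda>j. norm (F (k, j))) (B k))"
    by (rule summable_on_imp_summable[OF Infinite_Sum.abs_summable_summable[OF 2]])
  show "summable (\<lambda>k. norm (infsum (\<lambda>j. F (k, j)) (B k)))"
    by (rule summable_comparison_test'[OF 3, of 0]) (auto intro: norm_infsum_bound 1)
  have sF: "F summable_on Sigma UNIV B" using assms by (rule Infinite_Sum.abs_summable_summable)
  have sF': "(\<lambda>(x, y). F (x, y)) summable_on Sigma UNIV B" using sF by simp
  have "(\<lambda>k. infsum (\<lambda>j. F (k, j)) (B k)) summable_on UNIV"
    using summable_on_Sigma_banach[OF sF'] by simp
  hence "((\<lambda>k. infsum (\<lambda>j. F (k, j)) (B k)) has_sum infsum F (Sigma UNIV B)) UNIV"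
    unfolding infsum_Sigma_banach[OF sF, symmetric] by (rule has_sum_infsum)
  thus "(\<lambda>k. infsum (\<lambda>j. F (k, j)) (B k)) sums infsum F (Sigma UNIV B)"
    by (rule has_sum_imp_sums)
qed

lemma infsum_eq_suminf:
  fixes f :: "nat \<Rightarrow> complex"
  assumes "(\<lambda>n. norm (f n)) summable_on UNIV"
  shows "infsum f UNIV = suminf f"
  using has_sum_imp_sums[OF has_sum_infsum[OF Infinite_Sum.abs_summable_summable[OF assms]]]
  by (simp add: sums_iff)

text \<open>
  Fubini for a double series whose rows have absolute sums that are eventually below a summable
  sequence.  Columns and antidiagonals give the same total as rows; the antidiagonals are what the
  recursion for the coefficients produces.
\<close>
theorem double_series:
  fixes f :: "nat \<Rightarrow> nat \<Rightarrow> complex"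
  assumes rows: "\<And>j. summable (\<lambda>n. norm (f j n))"
    and bound: "eventually (\<lambda>j. (\<Sum>n. norm (f j n)) \<le> w j) sequentially"
    and w: "summable w"
  shows "summable (\<lambda>j. \<Sum>n. f j n)"
    and "(\<lambda>n. \<Sum>j. f j n) sums (\<Sum>j. \<Sum>n. f j n)"
    and "summable (\<lambda>k. norm (\<Sum>j=0..k. f j (k - j)))"
    and "(\<lambda>k. \<Sum>j=0..k. f j (k - j)) sums (\<Sum>j. \<Sum>n. f j n)"
proof -
  define F where "F = (\<lambda>(j, n). f j n)"
  have row: "(\<lambda>n. norm (f j n)) summable_on UNIV" for j
    using norm_summable_imp_summable_on[of "\<lambda>n. norm (f j n)"] rows[of j] by simp
  have row': "infsum (\<lambda>n. norm (f j n)) UNIV = (\<Sum>n. norm (f j n))" for j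
    using norm_summable_imp_has_sum[of "\<lambda>n. norm (f j n)"] rows[of j]
    by (auto intro!: infsumI simp: summable_sums)
  have "summable (\<lambda>j. \<Sum>n. norm (f j n))"
  proof (rule summable_comparison_test_ev[OF _ w])
    show "\<forall>\<^sub>F j in sequentially. norm (\<Sum>n. norm (f j n)) \<le> w j"
      using bound by eventually_elim (simp add: suminf_nonneg rows)
  qed
  hence "(\<lambda>j. norm (\<Sum>n. norm (f j n))) summable_on UNIV"
    using norm_summable_imp_summable_on[of "\<lambda>j. \<Sum>n. norm (f j n)"]
    by (simp add: suminf_nonneg rows)
  hence absF: "(\<lambda>x. norm (F x)) summable_on Sigma UNIV (\<lambda>_. UNIV)"
    unfolding Infinite_Sum.abs_summable_on_Sigma_iff F_def using row by (simp add: row')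
  note F = iterated_infsum[OF absF]
  have eq: "infsum F (Sigma UNIV (\<lambda>_. UNIV)) = (\<Sum>j. \<Sum>n. f j n)"
    and 1: "summable (\<lambda>j. \<Sum>n. f j n)"
    using F(2) infsum_eq_suminf[OF row] by (simp_all add: F_def sums_iff)
  show "summable (\<lambda>j. \<Sum>n. f j n)" by (rule 1)

  define F' where "F' = (\<lambda>(n, j). f j n)"
  have F': "(\<lambda>x. norm (F' x)) summable_on Sigma UNIV (\<lambda>_. UNIV)"
    using absF summable_on_reindex_bij_witness[of UNIV prod.swap prod.swap UNIV
        "\<lambda>x. norm (F x)" "\<lambda>x. norm (F' x)"]
    by (simp add: F_def F'_def split: prod.splits)
  have eq': "infsum F' (Sigma UNIV (\<lambda>_. UNIV)) = infsum F (Sigma UNIV (\<lambda>_. UNIV))"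
    by (rule infsum_reindex_bij_witness[of _ prod.swap prod.swap]) (auto simp: F_def F'_def)
  have col: "(\<lambda>j. norm (f j n)) summable_on UNIV" for n
    using F' unfolding Infinite_Sum.abs_summable_on_Sigma_iff by (simp add: F'_def)
  show "(\<lambda>n. \<Sum>j. f j n) sums (\<Sum>j. \<Sum>n. f j n)"
    using iterated_infsum(2)[OF F'] infsum_eq_suminf[OF col] unfolding eq' eq
    by (simp add: F'_def)

  define D where "D = (\<lambda>(k, j). f j (k - j))"
  have D: "(\<lambda>x. norm (D x)) summable_on Sigma UNIV (\<lambda>k. {0..k})"
    using absF summable_on_reindex_bij_witness[of "Sigma UNIV (\<lambda>k. {0..k})"
        "\<lambda>(j, n). (j + n, j)" "\<lambda>(k, j). (j, k - j)" UNIV "\<lambda>x. norm (F x)" "\<lambda>x. norm (D x)"]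
    by (auto simp: F_def D_def)
  have eqD: "infsum D (Sigma UNIV (\<lambda>k. {0..k})) = infsum F (Sigma UNIV (\<lambda>_. UNIV))"
    by (rule infsum_reindex_bij_witness[of _ "\<lambda>(j, n). (j + n, j)" "\<lambda>(k, j). (j, k - j)"])
       (auto simp: F_def D_def)
  show "summable (\<lambda>k. norm (\<Sum>j=0..k. f j (k - j)))"
    and "(\<lambda>k. \<Sum>j=0..k. f j (k - j)) sums (\<Sum>j. \<Sum>n. f j n)"
    using iterated_infsum[OF D] unfolding eqD eq by (simp_all add: D_def)
qed

text \<open>
  In Euler's limit, each factor \<open>z + i\<close> of the denominator is at least as large in modulus as its
  real part.
\<close>
lemma norm_Gamma_le:
  assumes "Re z > 0"
  shows "norm (Gamma z) \<le> norm (Gamma (of_real (Re z) :: complex))"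
proof (rule tendsto_le)
  show "(\<lambda>n. norm (Gamma_series (of_real (Re z) :: complex) n)) \<longlonglongrightarrow> norm (Gamma (of_real (Re z) :: complex))"
       "(\<lambda>n. norm (Gamma_series z n)) \<longlonglongrightarrow> norm (Gamma z)"
    by (intro tendsto_norm Gamma_series_LIMSEQ)+
  have "norm (Gamma_series z n) \<le> norm (Gamma_series (of_real (Re z) :: complex) n)" for n
  proof -
    have "norm (pochhammer (of_real (Re z) :: complex) (n + 1)) \<le> norm (pochhammer z (n + 1))"
      unfolding pochhammer_prod prod_norm[symmetric]
    proof (intro prod_mono conjI)
      fix i
      have "norm (of_real (Re z) + of_nat i :: complex) = \<bar>Re (z + of_nat i)\<bar>"
        using norm_of_real[of "Re z + real i", where 'a = complex] by simp
      thus "norm (of_real (Re z) + of_nat i :: complex) \<le> norm (z + of_nat i)"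
        using abs_Re_le_cmod by metis
    qed auto
    moreover have "pochhammer (of_real (Re z) :: complex) (n + 1) \<noteq> 0"
      using assms Re_pos_imp_notin_nonpos_Ints[of "of_real (Re z)"]
      by (auto dest: pochhammer_eq_0_imp_nonpos_Int simp del: of_real_in_nonpos_Ints_iff)
    ultimately show ?thesis
      unfolding Gamma_series_def norm_divide norm_mult
      by (intro frac_le) auto
  qed
  thus "\<forall>\<^sub>F n in sequentially. norm (Gamma_series z n) \<le> norm (Gamma_series (of_real (Re z) :: complex) n)"
    by simp
qed simp

lemma norm_rGamma_ge:
  assumes "Re z > 0"
  shows "norm (rGamma (of_real (Re z) :: complex)) \<le> norm (rGamma z)"
proof -
  have "Gamma z \<noteq> 0"
    using Re_pos_imp_notin_nonpos_Ints[OF assms] by (simp add: Gamma_eq_zero_iff)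
  thus ?thesis using norm_Gamma_le[OF assms]
    by (simp add: rGamma_inverse_Gamma norm_inverse le_imp_inverse_le)
qed

text \<open>
  A converse to \<open>norm_Gamma_le\<close> up to a factor, far to the right: both sides have the same asymptotics.
  Any constant above \<open>1\<close> would serve in place of \<open>2\<close>.
\<close>
lemma norm_rGamma_eventually_le:
  "eventually (\<lambda>n. norm (rGamma (z + of_nat n)) \<le> 2 * norm (rGamma (of_real (Re z) + of_nat n :: complex))) sequentially"
proof -
  define x :: complex where "x = of_real (Re z)"
  have "(\<lambda>n. norm (rGamma_ratio z n) - 2 * norm (rGamma_ratio x n)) \<longlonglongrightarrow> norm (1 :: complex) - 2 * norm (1 :: complex)"
    by (intro tendsto_intros rGamma_ratio_tendsto_1)
  hence "eventually (\<lambda>n. norm (rGamma_ratio z n) - 2 * norm (rGamma_ratio x n) < 0) sequentially"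
    by (rule order_tendstoD) simp
  thus ?thesis using eventually_gt_at_top[of 0]
  proof eventually_elim
    case (elim n)
    define c where "c = norm (Gamma (of_nat n :: complex)) * real n powr Re z"
    have "Gamma (of_nat n :: complex) \<noteq> 0"
      using elim by (simp add: Gamma_eq_zero_iff of_nat_in_nonpos_Ints_iff)
    hence c: "c > 0" using elim by (simp add: c_def)
    have "norm (rGamma_ratio y n) = norm (rGamma (y + of_nat n)) * c" if "Re y = Re z" for y
      using elim that norm_powr_real_powr[of "of_nat n :: complex" y]
      by (simp add: rGamma_ratio_def norm_mult c_def)
    from this[of z] this[of x] elim(1) have
      "norm (rGamma (z + of_nat n)) * c \<le> (2 * norm (rGamma (x + of_nat n))) * c" by (simp add: x_def)
    thus ?case using c by (simp add: x_def)
  qed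
qed

lemma norm_pochhammer_le:
  assumes "Re z > 0"
  shows "norm (pochhammer z n) \<le>
     norm (rGamma z) * norm (Gamma (of_real (Re z) :: complex)) * norm (pochhammer (of_real (Re z) :: complex) n)"
proof -
  define x :: complex where "x = of_real (Re z)"
  have nz: "z \<notin> \<int>\<^sub>\<le>\<^sub>0" "x \<notin> \<int>\<^sub>\<le>\<^sub>0" "Gamma x \<noteq> 0"
    using assms Re_pos_imp_notin_nonpos_Ints[of z] Re_pos_imp_notin_nonpos_Ints[of x]
    by (simp_all add: x_def Gamma_eq_zero_iff del: of_real_in_nonpos_Ints_iff)
  have "norm (pochhammer z n) = norm (rGamma z) * norm (Gamma (z + of_nat n))"
    using nz by (simp add: pochhammer_Gamma rGamma_inverse_Gamma norm_mult norm_divide norm_inverse field_simps)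
  also have "\<dots> \<le> norm (rGamma z) * norm (Gamma (x + of_nat n))"
    using assms norm_Gamma_le[of "z + of_nat n"] by (intro mult_left_mono) (auto simp: x_def)
  also have "\<dots> = norm (rGamma z) * norm (Gamma x) * norm (pochhammer x n)"
    using nz by (simp add: pochhammer_Gamma norm_divide)
  finally show ?thesis by (simp add: x_def)
qed

text \<open>
  For positive parameters all terms are nonnegative, so Gauss's theorem evaluates the absolute sum.
\<close>
lemma suminf_norm_gauss_term_real:
  fixes x y z :: real
  assumes "x > 0" "y > 0" "z > x + y"
  defines "g \<equiv> gauss_term (of_real x) (of_real y) (of_real z)"
  shows "(\<Sum>n. norm (g n)) = norm (Gamma (of_real (z - x - y) :: complex)) * norm (rGamma (of_real (z - x) :: complex))
           * norm (rGamma (of_real (z - y) :: complex))"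
proof -
  define r where "r n = pochhammer x n * pochhammer y n / fact n * rGamma (z + real n)" for n
  have g: "g n = of_real (r n)" for n
    by (simp add: g_def gauss_term_def r_def pochhammer_of_real flip: rGamma_complex_of_real)
  have r: "r n \<ge> 0" for n
  proof -
    have "rGamma (z + real n) \<ge> 0"
      using assms Gamma_real_pos[of "z + real n"] by (simp add: rGamma_inverse_Gamma)
    thus ?thesis using assms by (simp add: r_def pochhammer_nonneg)
  qed
  have "Re (of_real z - of_real x - of_real y) > 0" using assms by simp
  note G = gauss_summation[OF this, folded g_def] summable_norm_gauss_term[OF this, folded g_def]
  have "summable r" using G(2) r by (simp add: g)
  hence "(\<lambda>n. g n) sums of_real (\<Sum>n. r n)"
    unfolding g by (intro sums_of_real summable_sums)
  hence "norm (\<Sum>n. g n) = norm (of_real (\<Sum>n. r n) :: complex)"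
    by (simp add: sums_iff)
  also have "\<dots> = (\<Sum>n. r n)"
    using r \<open>summable r\<close> by (simp add: suminf_nonneg)
  also have "\<dots> = (\<Sum>n. norm (g n))" using r by (simp add: g)
  finally show ?thesis using G(1) by (simp add: sums_iff norm_mult)
qed

text \<open>
  Absolute values are compared with the series whose parameters are the real parts, and that series
  is summed by Gauss's theorem.  Positivity of \<open>Re (\<beta> - \<alpha>)\<close> is what makes the comparison
  series positive, and positivity of \<open>Re \<alpha>\<close> makes it converge.
\<close>
lemma suminf_norm_gauss_term_eventually_le:
  assumes \<alpha>: "Re \<alpha> > 0" and \<beta>: "Re \<beta> > Re \<alpha>"
  shows "\<exists>C. eventually (\<lambda>j. (\<Sum>n. norm (gauss_term (u + of_nat j) (\<beta> - \<alpha>) (u + \<beta> + of_nat j) n))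
               \<le> C * norm (rGamma (u + \<alpha> + of_nat j))) sequentially"
proof -
  define U V A B where "U = Re u" and "V = Re (\<beta> - \<alpha>)" and "A = Re \<alpha>" and "B = Re \<beta>"
  note defs = U_def V_def A_def B_def
  define K where "K = norm (rGamma (\<beta> - \<alpha>)) * norm (Gamma (of_real V :: complex))"
  obtain m0 where m0: "\<And>m. m \<ge> m0 \<Longrightarrow> norm (rGamma (u + \<beta> + of_nat m)) \<le> 2 * norm (rGamma (of_real (U + B) + of_nat m :: complex))"
    using norm_rGamma_eventually_le[of "u + \<beta>"] by (auto simp: eventually_at_top_linorder defs)
  have Upos: "eventually (\<lambda>j. U + real j > 0) sequentially"
  proof -
    obtain j0 :: nat where "real j0 > - U" using reals_Archimedean2 by blast
    thus ?thesis by (intro eventually_mono[OF eventually_ge_at_top[of j0]]) auto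
  qed
  have "eventually (\<lambda>j. (\<Sum>n. norm (gauss_term (u + of_nat j) (\<beta> - \<alpha>) (u + \<beta> + of_nat j) n))
     \<le> (4 * K * norm (Gamma (of_real A :: complex)) * norm (rGamma (of_real B :: complex)))
          * norm (rGamma (u + \<alpha> + of_nat j))) sequentially"
    using norm_rGamma_eventually_le[of u] eventually_ge_at_top[of m0] Upos
  proof eventually_elim
    case (elim j)
    define g where "g = gauss_term (of_real (U + j)) (of_real V) (of_real (U + B + j))"
    have pos: "U + real j > 0" "V > 0" "U + B + j > (U + j) + V" "A > 0"
      using elim \<alpha> \<beta> by (auto simp: defs)
    have Re: "Re (u + of_nat j) = U + j" "Re (\<beta> - \<alpha>) = V" by (simp_all add: defs)
    define P where "P = norm (rGamma (u + of_nat j)) * norm (Gamma (of_real (U + j) :: complex))"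
    have P: "P \<le> 2"
    proof -
      have "of_real (U + j) \<notin> (\<int>\<^sub>\<le>\<^sub>0 :: complex set)"
        using pos by (intro Re_pos_imp_notin_nonpos_Ints) auto
      hence "Gamma (of_real (U + j) :: complex) \<noteq> 0" by (simp only: Gamma_eq_zero_iff not_False_eq_True)
      hence "norm (rGamma (of_real (U + j) :: complex)) * norm (Gamma (of_real (U + j) :: complex)) = 1"
        by (simp add: rGamma_inverse_Gamma norm_inverse)
      moreover have "P \<le> (2 * norm (rGamma (of_real (U + j) :: complex))) * norm (Gamma (of_real (U + j) :: complex))"
        unfolding P_def using elim(1) by (intro mult_right_mono) (auto simp: defs)
      ultimately show ?thesis by simp
    qed
    \<comment> \<open>one factor 2 bounds \<open>P\<close>, the other one the quotient of the values of \<open>1/\<Gamma>\<close>\<close>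
    have term_le: "norm (gauss_term (u + of_nat j) (\<beta> - \<alpha>) (u + \<beta> + of_nat j) n) \<le> (4 * K) * norm (g n)" for n
    proof -
      have "norm (pochhammer (u + of_nat j) n) \<le> P * norm (pochhammer (of_real (U + j) :: complex) n)"
        using norm_pochhammer_le[of "u + of_nat j" n] pos unfolding Re P_def by simp
      also have "\<dots> \<le> 2 * norm (pochhammer (of_real (U + j) :: complex) n)"
        by (intro mult_right_mono P) auto
      finally have 1: "norm (pochhammer (u + of_nat j) n) \<le> 2 * norm (pochhammer (of_real (U + j) :: complex) n)" .
      have 2: "norm (pochhammer (\<beta> - \<alpha>) n) \<le> K * norm (pochhammer (of_real V :: complex) n)"
        using norm_pochhammer_le[of "\<beta> - \<alpha>" n] pos unfolding Re K_def by simp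
      have "norm (rGamma (u + \<beta> + of_nat (j + n))) \<le> 2 * norm (rGamma (of_real (U + B) + of_nat (j + n) :: complex))"
        using elim by (intro m0) auto
      hence 3: "norm (rGamma (u + \<beta> + of_nat j + of_nat n)) \<le> 2 * norm (rGamma (of_real (U + B + j) + of_nat n :: complex))"
        by (simp add: add_ac)
      have "norm (gauss_term (u + of_nat j) (\<beta> - \<alpha>) (u + \<beta> + of_nat j) n)
         \<le> (2 * norm (pochhammer (of_real (U + j) :: complex) n)) * (K * norm (pochhammer (of_real V :: complex) n))
            / fact n * (2 * norm (rGamma (of_real (U + B + j) + of_nat n :: complex)))"
        unfolding gauss_term_def norm_mult norm_divide norm_fact
        by (intro mult_mono divide_right_mono 1 2 3) (auto simp: K_def)
      also have "\<dots> = (4 * K) * norm (g n)"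
        by (simp add: g_def gauss_term_def norm_mult norm_divide)
      finally show ?thesis .
    qed
    have "summable (\<lambda>n. norm (g n))"
      unfolding g_def using pos by (intro summable_norm_gauss_term) auto
    moreover have "summable (\<lambda>n. norm (gauss_term (u + of_nat j) (\<beta> - \<alpha>) (u + \<beta> + of_nat j) n))"
      using \<alpha> by (intro summable_norm_gauss_term) auto
    ultimately have "(\<Sum>n. norm (gauss_term (u + of_nat j) (\<beta> - \<alpha>) (u + \<beta> + of_nat j) n))
        \<le> (\<Sum>n. (4 * K) * norm (g n))"
      by (intro suminf_le term_le summable_mult)
    also have "\<dots> = (4 * K) * (\<Sum>n. norm (g n))"
      using \<open>summable (\<lambda>n. norm (g n))\<close> by (rule suminf_mult)
    also have "(\<Sum>n. norm (g n)) = norm (Gamma (of_real A :: complex)) * norm (rGamma (of_real B :: complex))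
           * norm (rGamma (of_real (Re (u + \<alpha> + of_nat j)) :: complex))"
      using suminf_norm_gauss_term_real[OF pos(1-3)] by (simp add: g_def defs algebra_simps)
    also have "(4 * K) * \<dots> \<le> (4 * K) * (norm (Gamma (of_real A :: complex)) * norm (rGamma (of_real B :: complex))
           * norm (rGamma (u + \<alpha> + of_nat j)))"
      using pos by (intro mult_left_mono norm_rGamma_ge) (auto simp: K_def defs)
    finally show ?case by (simp only: mult_ac)
  qed
  thus ?thesis by blast
qed

text \<open>
  Multiplication by \<open>\<Gamma>(\<alpha>) / \<Gamma>(\<beta>)\<close> in terms of coefficients.  By Gauss's theorem each term
  \<open>\<Gamma>(\<alpha>) / (\<Gamma>(\<beta>) \<Gamma>(u + \<alpha> + j))\<close> is a series in \<open>1 / \<Gamma>(u + \<beta> + j + n)\<close>; collecting the terms with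
  equal \<open>j + n\<close> gives the new coefficients.
\<close>
theorem inverse_factorial_series_transform:
  fixes A' :: "nat \<Rightarrow> complex" and \<alpha> \<beta> u :: complex
  assumes \<alpha>: "Re \<alpha> > 0" and \<beta>: "Re \<beta> > Re \<alpha>"
    and A': "summable (\<lambda>j. norm (A' j * rGamma (u + \<alpha> + of_nat j)))"
  defines "A \<equiv> \<lambda>k. \<Sum>j=0..k. pochhammer (u + of_nat j) (k - j) * pochhammer (\<beta> - \<alpha>) (k - j) / fact (k - j) * A' j"
  shows "summable (\<lambda>k. norm (A k * rGamma (u + \<beta> + of_nat k)))"
    and "(\<lambda>k. A k * rGamma (u + \<beta> + of_nat k)) sums
           (Gamma \<alpha> * rGamma \<beta> * (\<Sum>j. A' j * rGamma (u + \<alpha> + of_nat j)))"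
proof -
  define f where "f j n = A' j * gauss_term (u + of_nat j) (\<beta> - \<alpha>) (u + \<beta> + of_nat j) n" for j n
  obtain C where C: "eventually (\<lambda>j. (\<Sum>n. norm (gauss_term (u + of_nat j) (\<beta> - \<alpha>) (u + \<beta> + of_nat j) n))
               \<le> C * norm (rGamma (u + \<alpha> + of_nat j))) sequentially"
    using suminf_norm_gauss_term_eventually_le[OF \<alpha> \<beta>] by blast
  have sg: "summable (\<lambda>n. norm (gauss_term (u + of_nat j) (\<beta> - \<alpha>) (u + \<beta> + of_nat j) n))" for j
    using \<alpha> by (intro summable_norm_gauss_term) auto
  have rows: "summable (\<lambda>n. norm (f j n))" for j
    unfolding f_def norm_mult by (intro summable_mult sg)
  have bound: "eventually (\<lambda>j. (\<Sum>n. norm (f j n)) \<le> C * norm (A' j * rGamma (u + \<alpha> + of_nat j))) sequentially"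
    using C
  proof eventually_elim
    case (elim j)
    have "(\<Sum>n. norm (f j n)) = norm (A' j) * (\<Sum>n. norm (gauss_term (u + of_nat j) (\<beta> - \<alpha>) (u + \<beta> + of_nat j) n))"
      unfolding f_def norm_mult by (intro suminf_mult sg)
    also have "\<dots> \<le> norm (A' j) * (C * norm (rGamma (u + \<alpha> + of_nat j)))"
      using elim by (intro mult_left_mono) auto
    finally show ?case by (simp add: norm_mult mult_ac)
  qed
  note D = double_series(3,4)[OF rows bound summable_mult[OF A']]
  have diag: "(\<Sum>j=0..k. f j (k - j)) = A k * rGamma (u + \<beta> + of_nat k)" for k
    unfolding A_def sum_distrib_right
  proof (rule sum.cong)
    fix j assume j: "j \<in> {0..k}"
    have eq: "u + \<beta> + of_nat j + of_nat (k - j) = u + \<beta> + of_nat k"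
      using j by (simp add: of_nat_diff)
    show "f j (k - j) = pochhammer (u + of_nat j) (k - j) * pochhammer (\<beta> - \<alpha>) (k - j) / fact (k - j) * A' j
            * rGamma (u + \<beta> + of_nat k)"
      unfolding f_def gauss_term_def eq by (simp only: mult_ac)
  qed simp
  have row: "(\<Sum>n. f j n) = (Gamma \<alpha> * rGamma \<beta>) * (A' j * rGamma (u + \<alpha> + of_nat j))" for j
  proof -
    have "gauss_term (u + of_nat j) (\<beta> - \<alpha>) (u + \<beta> + of_nat j) sums (Gamma \<alpha> * rGamma \<beta> * rGamma (u + \<alpha> + of_nat j))"
      using gauss_summation[of "u + \<beta> + of_nat j" "u + of_nat j" "\<beta> - \<alpha>"] \<alpha>
      by (simp add: algebra_simps)
    from sums_mult[OF this, of "A' j"] show ?thesis by (simp add: f_def sums_iff mult_ac)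
  qed
  have tot: "(\<Sum>j. \<Sum>n. f j n) = Gamma \<alpha> * rGamma \<beta> * (\<Sum>j. A' j * rGamma (u + \<alpha> + of_nat j))"
    unfolding row by (intro suminf_mult summable_norm_cancel[OF A'])
  show "summable (\<lambda>k. norm (A k * rGamma (u + \<beta> + of_nat k)))"
    using D(1) by (simp only: diag)
  show "(\<lambda>k. A k * rGamma (u + \<beta> + of_nat k)) sums
           (Gamma \<alpha> * rGamma \<beta> * (\<Sum>j. A' j * rGamma (u + \<alpha> + of_nat j)))"
    using D(2) by (simp only: diag tot)
qed

section \<open>The coefficients and inverse factorial series\<close>

text \<open>
  The parameter \<open>\<sigma>\<close> at which the inverse factorial series with coefficients \<open>A_coeff p a b\<close> starts.
\<close>
definition excess :: "nat \<Rightarrow> (nat \<Rightarrow> complex) \<Rightarrow> (nat \<Rightarrow> complex) \<Rightarrow> complex" where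
  "excess p a b = (\<Sum>j=1..p. b j) - (\<Sum>j=3..p + 1. a j)"

lemma A_coeff_step:
  "A_coeff (Suc (Suc n)) a b k = (\<Sum>j=0..k.
     pochhammer (excess (Suc (Suc n)) a b - b 1 + of_nat j) (k - j)
        * pochhammer (b 1 - a 3) (k - j) / fact (k - j)
        * A_coeff (Suc n) (\<lambda>i. a (Suc i)) (\<lambda>i. b (Suc i)) j)"
proof -
  have "(\<Sum>i=1..n+2. b i) = b 1 + (\<Sum>i=2..n+2. b i)"
    by (subst sum.atLeast_Suc_atMost) (auto simp: numeral_2_eq_2)
  hence "excess (Suc (Suc n)) a b - b 1 = (\<Sum>i=2..n+2. b i) - (\<Sum>i=3..n+3. a i)"
    by (simp add: excess_def numeral_3_eq_3)
  thus ?thesis by simp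
qed

lemma excess_Suc:
  "excess (Suc (Suc n)) a b = excess (Suc n) (\<lambda>i. a (Suc i)) (\<lambda>i. b (Suc i)) + b 1 - a 3"
proof -
  have "(\<Sum>i=1..Suc (Suc n). b i) = b 1 + (\<Sum>i=Suc 1..Suc (Suc n). b i)"
    by (subst sum.atLeast_Suc_atMost) auto
  moreover have "(\<Sum>i=3..Suc (Suc n) + 1. a i) = a 3 + (\<Sum>i=Suc 3..Suc (Suc n + 1). a i)"
    by (subst sum.atLeast_Suc_atMost) auto
  ultimately show ?thesis
    unfolding excess_def sum.shift_bounds_cl_Suc_ivl by simp
qed

declare A_coeff.simps(2) [simp del]

text \<open>
  Raising \<open>b 1\<close> changes the shifted family \<open>\<lambda>i. b (Suc i)\<close> at the index \<open>0\<close>; the coefficients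
  do not see this value.
\<close>
lemma A_coeff_cong:
  assumes "\<And>i. i \<ge> 1 \<Longrightarrow> b i = b' i"
  shows "A_coeff (Suc n) a b k = A_coeff (Suc n) a b' k"
  using assms
proof (induction n arbitrary: a b b' k)
  case (Suc n)
  have "A_coeff (Suc n) a' (\<lambda>i. b (Suc i)) j = A_coeff (Suc n) a' (\<lambda>i. b' (Suc i)) j" for a' j
    by (rule Suc.IH) (use Suc.prems in auto)
  moreover have "excess (Suc (Suc n)) a b = excess (Suc (Suc n)) a b'"
    unfolding excess_def using Suc.prems by (intro arg_cong2[of _ _ _ _ minus] sum.cong) auto
  moreover have "b 1 = b' 1" using Suc.prems by simp
  ultimately show ?case unfolding A_coeff_step by simp
qed simp

lemma A_coeff_0: "A_coeff (Suc n) a b 0 = 1"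
proof (induction n arbitrary: a b)
  case (Suc n)
  show ?case unfolding A_coeff_step by (simp add: Suc)
qed simp

text \<open>
  One step of the recursion for the coefficients, as a linear operator on sequences.
\<close>
definition coeff_transform :: "complex \<Rightarrow> complex \<Rightarrow> (nat \<Rightarrow> complex) \<Rightarrow> nat \<Rightarrow> complex" where
  "coeff_transform u x E k = (\<Sum>j=0..k. pochhammer (u + of_nat j) (k - j) * pochhammer x (k - j) / fact (k - j) * E j)"

lemma coeff_transform_Suc:
  "coeff_transform u x E (Suc k) = (\<Sum>j=0..k.
     pochhammer (u + of_nat j) (Suc (k - j)) * pochhammer x (Suc (k - j)) / fact (Suc (k - j)) * E j) + E (Suc k)"
  unfolding coeff_transform_def sum.atLeast0_atMost_Suc
  by (intro arg_cong2[of _ _ _ _ plus] sum.cong) (auto simp: Suc_diff_le)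

text \<open>
  Termwise this is Pascal's rule
  \<open>(x)_{n+1} / (n+1)! = (x+1)_{n+1} / (n+1)! - (x+1)_n / n!\<close>, since
  \<open>(u + j)_{n+1} = (u + j)_n (u + k)\<close> for \<open>k = j + n\<close>.
\<close>
lemma coeff_transform_raise_head:
  "coeff_transform u x E (Suc k) = coeff_transform u (x + 1) E (Suc k) - (u + of_nat k) * coeff_transform u (x + 1) E k"
proof -
  have "pochhammer (u + of_nat j) (Suc (k - j)) * pochhammer x (Suc (k - j)) / fact (Suc (k - j)) * E j
      = pochhammer (u + of_nat j) (Suc (k - j)) * pochhammer (x + 1) (Suc (k - j)) / fact (Suc (k - j)) * E j
        - (u + of_nat k) * (pochhammer (u + of_nat j) (k - j) * pochhammer (x + 1) (k - j) / fact (k - j) * E j)"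
    if "j \<in> {0..k}" for j
  proof -
    define n where "n = k - j"
    define P where "P = pochhammer (u + of_nat j) n"
    define X where "X = pochhammer (x + 1) n"
    have k: "of_nat k = (of_nat j + of_nat n :: complex)" using that by (simp add: n_def flip: of_nat_add)
    define N where "N = (of_nat (Suc n) :: complex)"
    have N: "N \<noteq> 0" by (simp add: N_def del: of_nat_Suc)
    have 1: "pochhammer x (Suc n) = x * X" by (simp add: X_def pochhammer_rec)
    have 2: "pochhammer (x + 1) (Suc n) = X * (x + N)"
      "pochhammer (u + of_nat j) (Suc n) = P * (u + of_nat k)"
      by (simp_all add: X_def P_def N_def k pochhammer_Suc add_ac)
    have 3: "fact (Suc n) = N * (fact n :: complex)" by (simp add: N_def)
    show ?thesis unfolding n_def[symmetric] P_def[symmetric] X_def[symmetric] 1 2 3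
      using N by (simp add: field_simps)
  qed
  thus ?thesis
    unfolding coeff_transform_Suc coeff_transform_def[of _ _ _ k]
    by (simp add: sum_subtractf sum_distrib_left)
qed

text \<open>
  The step operator commutes with the two-term relation that raising a parameter induces, with \<open>u\<close>
  and the coefficient \<open>s\<close> adjusted.  After collecting the coefficient of each \<open>E j\<close> it is an
  identity between rational functions.
\<close>
lemma coeff_transform_raise_tail:
  assumes "E' 0 = E 0" "\<And>j. E' (Suc j) = E (Suc j) - (s + of_nat j) * E j"
  shows "coeff_transform u x E' (Suc k) =
     coeff_transform (u + 1) x E (Suc k) - (s + x + of_nat k) * coeff_transform (u + 1) x E k"
proof -
  define c where "c v j = pochhammer (v + of_nat j) (k - j) * pochhammer x (k - j) / fact (k - j)" for v j
  define d where "d v j = pochhammer (v + of_nat j) (Suc (k - j)) * pochhammer x (Suc (k - j)) / fact (Suc (k - j))" for v j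
  have "coeff_transform u x E' (Suc k) = d u 0 * E' 0 +
      (\<Sum>j=0..k. pochhammer (u + of_nat (Suc j)) (k - j) * pochhammer x (k - j) / fact (k - j) * E' (Suc j))"
    unfolding coeff_transform_def d_def
    by (subst sum.atLeast0_atMost_Suc_shift) simp
  also have "\<dots> = d u 0 * E 0 + (\<Sum>j=0..k. c (u + 1) j * E (Suc j)) - (\<Sum>j=0..k. c (u + 1) j * ((s + of_nat j) * E j))"
  proof -
    have "pochhammer (u + of_nat (Suc j)) (k - j) * pochhammer x (k - j) / fact (k - j) = c (u + 1) j" for j
      by (simp add: c_def add_ac)
    thus ?thesis unfolding assms by (simp add: right_diff_distrib sum_subtractf)
  qed
  also have "d u 0 * E 0 + (\<Sum>j=0..k. c (u + 1) j * E (Suc j)) = coeff_transform u x E (Suc k)"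
    unfolding coeff_transform_def c_def d_def
    by (subst sum.atLeast0_atMost_Suc_shift) (simp add: add_ac)
  also have "\<dots> = (\<Sum>j=0..k. d u j * E j) + E (Suc k)"
    unfolding coeff_transform_Suc d_def ..
  finally have L: "coeff_transform u x E' (Suc k) = (\<Sum>j=0..k. (d u j - (s + of_nat j) * c (u + 1) j) * E j) + E (Suc k)"
    by (simp add: sum_subtractf algebra_simps)
  have R: "coeff_transform (u + 1) x E (Suc k) - (s + x + of_nat k) * coeff_transform (u + 1) x E k
      = (\<Sum>j=0..k. (d (u + 1) j - (s + x + of_nat k) * c (u + 1) j) * E j) + E (Suc k)"
    unfolding coeff_transform_Suc coeff_transform_def[of _ _ _ k] d_def c_def sum_distrib_left
    by (simp add: sum_subtractf algebra_simps)
  have "d u j - (s + of_nat j) * c (u + 1) j = d (u + 1) j - (s + x + of_nat k) * c (u + 1) j"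
    if "j \<in> {0..k}" for j
  proof -
    define n where "n = k - j"
    define P where "P = pochhammer (u + 1 + of_nat j) n"
    define X where "X = pochhammer x n"
    define N where "N = (of_nat (Suc n) :: complex)"
    have N: "N \<noteq> 0" by (simp add: N_def del: of_nat_Suc)
    have k: "of_nat k = of_nat j + N - 1" using that by (simp add: n_def N_def flip: of_nat_add)
    have 1: "pochhammer (u + of_nat j) (Suc n) = (u + of_nat j) * P"
      by (simp add: pochhammer_rec P_def add_ac)
    have 2: "pochhammer (u + 1 + of_nat j) (Suc n) = P * (u + of_nat j + N)" "pochhammer x (Suc n) = X * (x + N - 1)"
      by (simp_all add: pochhammer_Suc P_def X_def N_def add_ac)
    have 3: "fact (Suc n) = N * (fact n :: complex)" by (simp add: N_def)
    show ?thesis unfolding d_def c_def n_def[symmetric] P_def[symmetric] X_def[symmetric] 1 2 3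
      unfolding k using N by (simp add: field_simps)
  qed
  thus ?thesis unfolding L R by simp
qed

lemma excess_raise:
  assumes "i \<in> {1..p}"
  shows "excess p a (b(i := y)) = excess p a b - b i + y"
proof -
  have "(\<Sum>j=1..p. (b(i := y)) j) = y + (\<Sum>j\<in>{1..p} - {i}. b j)"
    using assms by (subst sum.remove[of _ i]) (auto intro: sum.cong)
  moreover have "(\<Sum>j=1..p. b j) = b i + (\<Sum>j\<in>{1..p} - {i}. b j)"
    using assms by (intro sum.remove) auto
  ultimately show ?thesis by (simp add: excess_def)
qed

text \<open>
  The counterpart for coefficients of \<open>1/\<Gamma>(b_i + l) = (b_i + l) / \<Gamma>(b_i + 1 + l)\<close>, where
  \<open>b_i + l = (\<sigma> + l + k) - (\<sigma> - b_i + k)\<close> in front of \<open>1/\<Gamma>(\<sigma> + 1 + l + k)\<close>.  Induction on the number of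
  parameters: the first parameter enters only the outermost step, the others only the inner ones
  and the base point \<open>u\<close>.
\<close>
lemma A_coeff_raise:
  assumes "i \<in> {1..Suc n}"
  shows "A_coeff (Suc n) a b (Suc k) = A_coeff (Suc n) a (b(i := b i + 1)) (Suc k)
          - (excess (Suc n) a b - b i + of_nat k) * A_coeff (Suc n) a (b(i := b i + 1)) k"
  using assms
proof (induction n arbitrary: i a b k)
  case 0
  thus ?case by (auto simp: excess_def)
next
  case (Suc n)
  define b' where "b' = b(i := b i + 1)"
  define u where "u = excess (Suc (Suc n)) a b - b 1"
  define \<sigma> where "\<sigma> = excess (Suc n) (\<lambda>i. a (Suc i)) (\<lambda>i. b (Suc i))"
  define A where "A = A_coeff (Suc n) (\<lambda>i. a (Suc i))"
  have step: "A_coeff (Suc (Suc n)) a c m =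
      coeff_transform (excess (Suc (Suc n)) a c - c 1) (c 1 - a 3) (A (\<lambda>i. c (Suc i))) m" for c m
    unfolding A_coeff_step coeff_transform_def A_def ..
  have ex: "excess (Suc (Suc n)) a b' = excess (Suc (Suc n)) a b + 1"
    unfolding b'_def using Suc.prems by (subst excess_raise) auto
  show ?case
  proof (cases "i = 1")
    case True
    have "A (\<lambda>i. b' (Suc i)) m = A (\<lambda>i. b (Suc i)) m" for m
      unfolding A_def b'_def by (rule A_coeff_cong) (simp add: True)
    hence AA: "A (\<lambda>i. b' (Suc i)) = A (\<lambda>i. b (Suc i))" by (rule ext)
    have b1: "b' 1 = b 1 + 1" by (simp add: b'_def True)
    have e: "excess (Suc (Suc n)) a b' - b' 1 = u" "b' 1 - a 3 = b 1 - a 3 + 1"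
      "excess (Suc (Suc n)) a b - b i = u"
      unfolding ex b1 u_def True by simp_all
    have "coeff_transform u (b 1 - a 3) (A (\<lambda>i. b (Suc i))) (Suc k)
       = coeff_transform u (b 1 - a 3 + 1) (A (\<lambda>i. b (Suc i))) (Suc k)
          - (u + of_nat k) * coeff_transform u (b 1 - a 3 + 1) (A (\<lambda>i. b (Suc i))) k"
      by (rule coeff_transform_raise_head)
    thus ?thesis unfolding b'_def[symmetric] step e AA u_def[symmetric] .
  next
    case False
    then obtain i' where i': "i = Suc i'" "i' \<in> {1..Suc n}" using Suc.prems by (cases i) auto
    define E where "E = A (\<lambda>i. b' (Suc i))"
    have upd: "(\<lambda>i. b (Suc i))(i' := b (Suc i') + 1) = (\<lambda>i. b' (Suc i))"
      by (auto simp: b'_def i')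
    have b1: "b' 1 = b 1" using False by (simp add: b'_def)
    have "coeff_transform u (b 1 - a 3) (A (\<lambda>i. b (Suc i))) (Suc k)
       = coeff_transform (u + 1) (b 1 - a 3) E (Suc k)
          - ((\<sigma> - b i) + (b 1 - a 3) + of_nat k) * coeff_transform (u + 1) (b 1 - a 3) E k"
    proof (rule coeff_transform_raise_tail)
      show "A (\<lambda>i. b (Suc i)) 0 = E 0" by (simp add: A_def E_def A_coeff_0)
      show "A (\<lambda>i. b (Suc i)) (Suc j) = E (Suc j) - ((\<sigma> - b i) + of_nat j) * E j" for j
        using Suc.IH[OF i'(2), of "\<lambda>i. a (Suc i)" "\<lambda>i. b (Suc i)" j]
        unfolding upd by (simp add: A_def E_def \<sigma>_def i')
    qed
    moreover have e: "excess (Suc (Suc n)) a b' - b' 1 = u + 1" "b' 1 - a 3 = b 1 - a 3"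
      unfolding ex b1 u_def by simp_all
    moreover have e': "excess (Suc (Suc n)) a b - b i = (\<sigma> - b i) + (b 1 - a 3)"
      unfolding excess_Suc \<sigma>_def by simp
    ultimately show ?thesis unfolding b'_def[symmetric] step e e' E_def[symmetric] u_def[symmetric] by blast
  qed
qed

text \<open>
  Raising \<open>b_1\<close> from \<open>b\<close>, and raising \<open>b_p\<close> from the family with first parameter \<open>b_1 + 1\<close> and last
  parameter \<open>b_p - 1\<close>, lead to the same family.  In the difference of the two relations the growing
  factor \<open>k\<close> cancels, so absolute convergence is inherited.
\<close>
lemma A_coeff_exchange:
  fixes n :: nat
  defines "p \<equiv> Suc (Suc n)"
  shows "A_coeff p a b (Suc k) = A_coeff p a (b(1 := b 1 + 1, p := b p - 1)) (Suc k)
          + (b 1 - b p + 1) * A_coeff p a (b(1 := b 1 + 1)) k"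
proof -
  define b1 where "b1 = b(1 := b 1 + 1)"
  define b2 where "b2 = b(1 := b 1 + 1, p := b p - 1)"
  have p: "p \<noteq> 1" by (simp add: p_def)
  have "b2(p := b2 p + 1) = b1" using p by (auto simp: b1_def b2_def)
  moreover have "excess p a b2 = excess p a b"
    unfolding b2_def using p by (subst excess_raise, simp add: p_def, subst excess_raise) (auto simp: p_def)
  ultimately have 1: "A_coeff p a b2 (Suc k) = A_coeff p a b1 (Suc k)
          - (excess p a b - b p + 1 + of_nat k) * A_coeff p a b1 k"
    using A_coeff_raise[of p "Suc n" a b2 k] by (simp add: p_def b2_def)
  have 2: "A_coeff p a b (Suc k) = A_coeff p a b1 (Suc k)
          - (excess p a b - b 1 + of_nat k) * A_coeff p a b1 k"
    using A_coeff_raise[of 1 "Suc n" a b k] by (simp add: p_def b1_def)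
  show ?thesis unfolding b2_def[symmetric] unfolding b1_def[symmetric] 1 2 by (simp add: algebra_simps)
qed

text \<open>
  Induction on \<open>p\<close>, and inside it on the number \<open>N\<close> of unit steps by which \<open>b_1\<close> must be raised
  until its real part exceeds that of \<open>a_3\<close>.
\<close>
theorem gamma_quotient_inverse_factorial_series:
  fixes l :: nat
  assumes "\<And>j. j \<in> {3..Suc n + 1} \<Longrightarrow> Re (a j) > 0"
  shows "summable (\<lambda>k. norm (A_coeff (Suc n) a b k * rGamma (excess (Suc n) a b + of_nat l + of_nat k))) \<and>
         (\<lambda>k. A_coeff (Suc n) a b k * rGamma (excess (Suc n) a b + of_nat l + of_nat k)) sums
           ((\<Prod>j=3..Suc n + 1. Gamma (a j + of_nat l)) * (\<Prod>j=1..Suc n. rGamma (b j + of_nat l)))"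
  using assms
proof (induction n arbitrary: a b)
  case 0
  define g where "g k = A_coeff (Suc 0) a b k * rGamma (excess (Suc 0) a b + of_nat l + of_nat k)" for k
  have g: "g k = (if k = 0 then rGamma (b 1 + of_nat l) else 0)" for k
    by (simp add: g_def excess_def)
  have "summable (\<lambda>k. norm (g k))"
    by (rule summable_finite[of "{0}"]) (auto simp: g)
  moreover have "g sums rGamma (b 1 + of_nat l)"
    using sums_single[of 0 "\<lambda>_. rGamma (b 1 + of_nat l)"] unfolding g[abs_def] by (simp add: eq_commute)
  ultimately show ?case unfolding g_def by (simp del: A_coeff.simps)
next
  case (Suc n)
  define p where "p = Suc (Suc n)"
  define F where "F b = (\<Prod>j=3..p + 1. Gamma (a j + of_nat l)) * (\<Prod>j=1..p. rGamma (b j + of_nat l))" for b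
  define h where "h b k = A_coeff p a b k * rGamma (excess p a b + of_nat l + of_nat k)" for b k
  have "summable (\<lambda>k. norm (h b k)) \<and> h b sums F b" if "Re (b 1) + real N > Re (a 3)" for N b
    using that
  proof (induction N arbitrary: b)
    case 0
    define u where "u = excess p a b - b 1"
    define A' where "A' = A_coeff (Suc n) (\<lambda>i. a (Suc i)) (\<lambda>i. b (Suc i))"
    define \<alpha> \<beta> where "\<alpha> = a 3 + of_nat l" and "\<beta> = b 1 + of_nat l"
    have pos: "Re \<alpha> > 0" "Re \<beta> > Re \<alpha>"
      using Suc.prems[of 3] 0 by (auto simp: \<alpha>_def \<beta>_def)
    have IH: "summable (\<lambda>k. norm (A' k * rGamma (excess (Suc n) (\<lambda>i. a (Suc i)) (\<lambda>i. b (Suc i)) + of_nat l + of_nat k))) \<and>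
         (\<lambda>k. A' k * rGamma (excess (Suc n) (\<lambda>i. a (Suc i)) (\<lambda>i. b (Suc i)) + of_nat l + of_nat k)) sums
           ((\<Prod>j=3..Suc n + 1. Gamma (a (Suc j) + of_nat l)) * (\<Prod>j=1..Suc n. rGamma (b (Suc j) + of_nat l)))"
      unfolding A'_def by (rule Suc.IH) (use Suc.prems in auto)
    have ex: "excess (Suc n) (\<lambda>i. a (Suc i)) (\<lambda>i. b (Suc i)) + of_nat l = u + \<alpha>"
      unfolding u_def p_def excess_Suc \<alpha>_def by simp
    note IH = IH[unfolded ex]
    \<comment> \<open>the shift by \<open>l\<close> cancels in \<open>\<beta> - \<alpha>\<close>, so the coefficients are independent of \<open>l\<close>\<close>
    have h: "(\<Sum>j=0..k. pochhammer (u + of_nat j) (k - j) * pochhammer (\<beta> - \<alpha>) (k - j) / fact (k - j) * A' j)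
               * rGamma (u + \<beta> + of_nat k) = h b k" for k
    proof -
      have e: "u + \<beta> = excess p a b + of_nat l" "\<beta> - \<alpha> = b 1 - a 3"
        by (simp_all add: u_def \<alpha>_def \<beta>_def)
      show ?thesis unfolding e h_def A'_def unfolding u_def p_def A_coeff_step ..
    qed
    note T = inverse_factorial_series_transform[OF pos conjunct1[OF IH], unfolded h]
    have "Gamma \<alpha> * rGamma \<beta> * (\<Sum>j. A' j * rGamma (u + \<alpha> + of_nat j)) = F b"
    proof -
      have 1: "(\<Prod>j=3..p + 1. Gamma (a j + of_nat l)) = Gamma \<alpha> * (\<Prod>j=Suc 3..Suc (Suc n + 1). Gamma (a j + of_nat l))"
        by (subst prod.atLeast_Suc_atMost) (auto simp: p_def \<alpha>_def)
      have 2: "(\<Prod>j=1..p. rGamma (b j + of_nat l)) = rGamma \<beta> * (\<Prod>j=Suc 1..Suc (Suc n). rGamma (b j + of_nat l))"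
        by (subst prod.atLeast_Suc_atMost) (auto simp: p_def \<beta>_def)
      show ?thesis unfolding F_def 1 2 prod.shift_bounds_cl_Suc_ivl
        using conjunct2[OF IH] by (simp add: sums_iff mult_ac)
    qed
    thus ?case using T by simp
  next
    case (Suc N)
    define b1 where "b1 = b(1 := b 1 + 1)"
    define b2 where "b2 = b(1 := b 1 + 1, p := b p - 1)"
    define c where "c = b 1 - b p + 1"
    have p: "p \<noteq> 1" "1 \<in> {1..p}" "p \<in> {1..p}" by (auto simp: p_def)
    have le1: "Re (b1 1) + real N > Re (a 3)" and le2: "Re (b2 1) + real N > Re (a 3)"
      using Suc.prems p by (simp_all add: b1_def b2_def)
    have I1: "summable (\<lambda>k. norm (h b1 k))" "h b1 sums F b1"
      and I2: "summable (\<lambda>k. norm (h b2 k))" "h b2 sums F b2"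
      using Suc.IH[of b1] Suc.IH[of b2] le1 le2 by blast+
    have ex1: "excess p a b1 = excess p a b + 1" and ex2: "excess p a b2 = excess p a b"
      using p by (simp_all add: b1_def b2_def excess_raise)
    have h0: "h b 0 = h b2 0"
      unfolding h_def ex2 by (simp add: p_def A_coeff_0)
    have hS: "h b (Suc k) = h b2 (Suc k) + c * h b1 k" for k
    proof -
      have "A_coeff p a b (Suc k) = A_coeff p a b2 (Suc k) + c * A_coeff p a b1 k"
        using A_coeff_exchange[of n a b k] by (simp only: b1_def b2_def c_def p_def)
      moreover have "excess p a b1 + of_nat l + of_nat k = excess p a b + of_nat l + of_nat (Suc k)"
        unfolding ex1 by simp
      ultimately show ?thesis unfolding h_def ex2 by (simp only: distrib_right mult.assoc)
    qed
    have "summable (\<lambda>k. norm (h b2 (Suc k)) + norm c * norm (h b1 k))"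
      using I1(1) I2(1) summable_Suc_iff[of "\<lambda>k. norm (h b2 k)"] by (intro summable_add summable_mult) auto
    hence "summable (\<lambda>k. norm (h b (Suc k)))"
      by (rule summable_comparison_test'[of _ 0])
         (auto simp: hS intro!: order.trans[OF norm_triangle_ineq] simp flip: norm_mult)
    hence s: "summable (\<lambda>k. norm (h b k))" using summable_Suc_iff[of "\<lambda>k. norm (h b k)"] by simp
    have "(\<lambda>k. h b2 (Suc k) + c * h b1 k) sums ((F b2 - h b2 0) + c * F b1)"
      using I1(2) I2(2) by (intro sums_add sums_mult) (simp add: sums_Suc_iff)
    hence "(\<lambda>k. h b (Suc k)) sums ((F b2 - h b2 0) + c * F b1)" by (simp only: hS)
    hence "h b sums ((F b2 - h b2 0) + c * F b1 + h b 0)" by (simp add: sums_Suc_iff)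
    hence "h b sums (F b2 + c * F b1)" by (simp add: h0 algebra_simps)
    also have "F b2 + c * F b1 = F b"
    proof -
      \<comment> \<open>the factors that the three families share\<close>
      define R where "R = (\<Prod>j=3..p + 1. Gamma (a j + of_nat l)) * (\<Prod>j\<in>{1..p} - {1} - {p}. rGamma (b j + of_nat l))"
      have split: "F d = R * rGamma (d 1 + of_nat l) * rGamma (d p + of_nat l)"
        if "\<And>j. j \<noteq> 1 \<Longrightarrow> j \<noteq> p \<Longrightarrow> d j = b j" for d
      proof -
        have "(\<Prod>j=1..p. rGamma (d j + of_nat l)) = rGamma (d 1 + of_nat l) * (\<Prod>j\<in>{1..p} - {1}. rGamma (d j + of_nat l))"
          using p by (intro prod.remove) auto
        also have "(\<Prod>j\<in>{1..p} - {1}. rGamma (d j + of_nat l)) =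
            rGamma (d p + of_nat l) * (\<Prod>j\<in>{1..p} - {1} - {p}. rGamma (d j + of_nat l))"
          using p by (intro prod.remove) auto
        also have "(\<Prod>j\<in>{1..p} - {1} - {p}. rGamma (d j + of_nat l)) = (\<Prod>j\<in>{1..p} - {1} - {p}. rGamma (b j + of_nat l))"
          using that by (intro prod.cong) auto
        finally show ?thesis by (simp add: F_def R_def mult_ac)
      qed
      have F1: "F b1 = R * rGamma (b 1 + 1 + of_nat l) * rGamma (b p + of_nat l)"
        using split[of b1] p by (simp add: b1_def)
      have F2: "F b2 = R * rGamma (b 1 + 1 + of_nat l) * rGamma (b p - 1 + of_nat l)"
        using split[of b2] p by (simp add: b2_def)
      have r1: "rGamma (b 1 + of_nat l) = (b 1 + of_nat l) * rGamma (b 1 + 1 + of_nat l)"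
        using rGamma_plus1[of "b 1 + of_nat l"] by (simp add: add_ac)
      have r2: "rGamma (b p - 1 + of_nat l) = (b p - 1 + of_nat l) * rGamma (b p + of_nat l)"
        using rGamma_plus1[of "b p - 1 + of_nat l"] by (simp add: add_ac)
      show ?thesis
        unfolding F1 F2 split[OF refl] c_def r1 r2 by (simp add: algebra_simps)
    qed
    finally show ?case using s by simp
  qed
  moreover obtain N :: nat where "real N > Re (a 3) - Re (b 1)" using reals_Archimedean2 by blast
  ultimately have "summable (\<lambda>k. norm (h b k)) \<and> h b sums F b" by (simp add: algebra_simps)
  thus ?case by (simp only: h_def[abs_def] F_def p_def)
qed

section \<open>Hypergeometric partial sums\<close>

lemma one_plus_bigo_mult:
  fixes f g :: "nat \<Rightarrow> complex"
  assumes "(\<lambda>n. f n - 1) \<in> O(\<lambda>n. 1 / of_nat n)" "(\<lambda>n. g n - 1) \<in> O(\<lambda>n. 1 / of_nat n)"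
  shows "(\<lambda>n. f n * g n - 1) \<in> O(\<lambda>n. 1 / of_nat n)"
proof -
  have "(\<lambda>n. 1 / of_nat n :: complex) \<in> O(\<lambda>_. 1)"
    by (rule bigoI_tendsto[of _ _ 0]) (use lim_1_over_n in auto)
  with assms(2) have "(\<lambda>n. g n - 1) \<in> O(\<lambda>_. 1)"
    by (rule landau_o.big_trans)
  from sum_in_bigo(1)[OF this, of "\<lambda>_. 1"] have "g \<in> O(\<lambda>_. 1)" by simp
  hence "(\<lambda>n. (f n - 1) * g n) \<in> O(\<lambda>n. 1 / of_nat n * 1)"
    using assms(1) by (intro landau_o.big.mult) simp_all
  hence "(\<lambda>n. (f n - 1) * g n + (g n - 1)) \<in> O(\<lambda>n. 1 / of_nat n)"
    by (intro sum_in_bigo(1) assms(2)) simp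
  thus ?thesis by (simp add: algebra_simps)
qed

lemma one_plus_bigo_inverse:
  fixes f :: "nat \<Rightarrow> complex"
  assumes "(\<lambda>n. f n - 1) \<in> O(\<lambda>n. 1 / of_nat n)" and lim: "f \<longlonglongrightarrow> 1"
  shows "(\<lambda>n. inverse (f n) - 1) \<in> O(\<lambda>n. 1 / of_nat n)"
proof -
  have "(\<lambda>n. inverse (f n)) \<longlonglongrightarrow> inverse 1" by (intro tendsto_inverse lim) simp
  hence "(\<lambda>n. inverse (f n)) \<in> O(\<lambda>_. 1)" by (intro bigoI_tendsto[of _ _ 1]) simp_all
  moreover have "(\<lambda>n. - (f n - 1)) \<in> O(\<lambda>n. 1 / of_nat n)"
    using assms(1) by (simp only: landau_o.big.uminus_in_iff)
  ultimately have "(\<lambda>n. - (f n - 1) * inverse (f n)) \<in> O(\<lambda>n. 1 / of_nat n * 1)"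
    by (intro landau_o.big.mult)
  also have "?this \<longleftrightarrow> (\<lambda>n. inverse (f n) - 1) \<in> O(\<lambda>n. 1 / of_nat n * 1)"
    using tendsto_imp_eventually_ne[OF lim, of 0]
    by (intro landau_o.big.in_cong) (auto elim!: eventually_mono simp: field_simps)
  finally show ?thesis by simp
qed

lemma one_plus_bigo_prod:
  fixes f :: "'a \<Rightarrow> nat \<Rightarrow> complex"
  assumes "\<And>i. i \<in> S \<Longrightarrow> (\<lambda>n. f i n - 1) \<in> O(\<lambda>n. 1 / of_nat n)"
  shows "(\<lambda>n. (\<Prod>i\<in>S. f i n) - 1) \<in> O(\<lambda>n. 1 / of_nat n)"
  using assms
proof (induction S rule: infinite_finite_induct)
  case (insert i S)
  thus ?case by (simp add: one_plus_bigo_mult)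
qed simp_all

definition hypergeom_term :: "nat \<Rightarrow> (nat \<Rightarrow> complex) \<Rightarrow> (nat \<Rightarrow> complex) \<Rightarrow> nat \<Rightarrow> complex" where
  "hypergeom_term p a b l = (\<Prod>j=1..p + 1. Gamma (a j + of_nat l)) * (\<Prod>j=1..p. rGamma (b j + of_nat l))
                  / Gamma (1 + of_nat l)"

text \<open>
  All Gamma factors are replaced by their asymptotic equivalents; the powers of \<open>n\<close> combine to
  \<open>n^{-3}\<close> because the parameters balance to \<open>2\<close>, the remaining power coming from \<open>1/\<Gamma>(1 + n)\<close>.
\<close>
lemma hypergeom_term_asymp:
  assumes "(\<Sum>j=1..p. b j) - (\<Sum>j=1..p + 1. a j) = 2"
  shows "(\<lambda>n. hypergeom_term p a b n - 1 / of_nat n ^ 3) \<in> O(\<lambda>n. 1 / of_nat n ^ 4)"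
proof -
  define q where "q n = (\<Prod>j=1..p + 1. inverse (rGamma_ratio (a j) n)) * (\<Prod>j=1..p. rGamma_ratio (b j) n)" for n
  have q: "(\<lambda>n. q n - 1) \<in> O(\<lambda>n. 1 / of_nat n)"
    unfolding q_def
    by (intro one_plus_bigo_mult one_plus_bigo_prod one_plus_bigo_inverse rGamma_ratio_bigo rGamma_ratio_tendsto_1)
  have "eventually (\<lambda>n. \<forall>j\<in>{1..p+1}. rGamma_ratio (a j) n \<noteq> 0) sequentially"
    by (intro eventually_ball_finite ballI rGamma_ratio_nonzero) auto
  hence "eventually (\<lambda>n. hypergeom_term p a b n - 1 / of_nat n ^ 3 = (q n - 1) * (1 / of_nat n ^ 3)) sequentially"
    using eventually_gt_at_top[of 0]
  proof eventually_elim
    case (elim n)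
    define N G where "N = (of_nat n :: complex)" and "G = Gamma N"
    have nz: "N \<noteq> 0" "G \<noteq> 0" "\<And>z. N powr z \<noteq> 0"
      using elim by (auto simp: N_def G_def Gamma_eq_zero_iff of_nat_in_nonpos_Ints_iff)
    have rG: "rGamma (z + N) = rGamma_ratio z n / (G * N powr z)" for z
      using nz by (simp add: rGamma_ratio_def N_def G_def)
    have a: "(\<Prod>j=1..p+1. Gamma (a j + N)) = (\<Prod>j=1..p+1. inverse (rGamma_ratio (a j) n)) * (G ^ (p + 1) * N powr (\<Sum>j=1..p+1. a j))"
    proof -
      have "Gamma (z + N) = inverse (rGamma_ratio z n) * (G * N powr z)" for z
        unfolding Gamma_def rG by (simp add: field_simps)
      hence "(\<Prod>j=1..p+1. Gamma (a j + N)) = (\<Prod>j=1..p+1. inverse (rGamma_ratio (a j) n) * (G * N powr a j))"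
        by (simp only:)
      also have "\<dots> = (\<Prod>j=1..p+1. inverse (rGamma_ratio (a j) n)) * (G ^ (p + 1) * (\<Prod>j=1..p+1. N powr a j))"
        by (simp only: prod.distrib prod_constant card_atLeastAtMost) simp
      also have "(\<Prod>j=1..p+1. N powr a j) = N powr (\<Sum>j=1..p+1. a j)"
        by (rule powr_sum[OF nz(1), symmetric])
      finally show ?thesis .
    qed
    have b: "(\<Prod>j=1..p. rGamma (b j + N)) = (\<Prod>j=1..p. rGamma_ratio (b j) n) / (G ^ p * N powr (\<Sum>j=1..p. b j))"
    proof -
      have "(\<Prod>j=1..p. rGamma (b j + N)) = (\<Prod>j=1..p. rGamma_ratio (b j) n) / (G ^ p * (\<Prod>j=1..p. N powr b j))"
        unfolding rG by (simp add: prod_dividef prod.distrib)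
      thus ?thesis unfolding powr_sum[OF nz(1)] .
    qed
    have G1: "Gamma (1 + N) = N * G"
      using Gamma_plus1[of N] elim by (simp add: G_def N_def add.commute of_nat_in_nonpos_Ints_iff)
    have "(\<Sum>j=1..p. b j) = (\<Sum>j=1..p+1. a j) + 2" using assms by (simp add: algebra_simps)
    hence pw: "N powr (\<Sum>j=1..p. b j) = N powr (\<Sum>j=1..p+1. a j) * N ^ 2"
      using nz by (simp only: powr_add) (simp add: powr_numeral)
    have "hypergeom_term p a b n = q n * (1 / N ^ 3)"
      unfolding hypergeom_term_def N_def[symmetric] a b G1 pw q_def
      using nz by (simp add: power3_eq_cube power2_eq_square mult_ac)
    thus ?case by (simp add: N_def left_diff_distrib diff_divide_distrib)
  qed
  hence "?thesis \<longleftrightarrow> (\<lambda>n. (q n - 1) * (1 / of_nat n ^ 3)) \<in> O(\<lambda>n. 1 / of_nat n ^ 4)"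
    by (rule landau_o.big.in_cong)
  moreover have "(\<lambda>n. (q n - 1) * (1 / of_nat n ^ 3)) \<in> O(\<lambda>n. 1 / of_nat n * (1 / of_nat n ^ 3))"
    by (rule landau_o.big.mult[OF q landau_o.big_refl])
  moreover have "(\<lambda>n. 1 / of_nat n ^ 4 :: complex) = (\<lambda>n. 1 / of_nat n * (1 / of_nat n ^ 3))"
    by (simp add: power_numeral_reduce)
  ultimately show ?thesis by simp
qed

lemma telescoping_correction_bigo:
  "(\<lambda>n. 1 / of_nat n ^ 3 - 1 / (of_nat n * (of_nat n - 1) * (of_nat n - 2)) :: complex) \<in> O(\<lambda>n. 1 / of_nat n ^ 4)"
proof (rule bigoI[of _ 12])
  show "\<forall>\<^sub>F n in sequentially. norm (1 / of_nat n ^ 3 - 1 / (of_nat n * (of_nat n - 1) * (of_nat n - 2)) :: complex)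
          \<le> 12 * norm (1 / of_nat n ^ 4 :: complex)"
    using eventually_ge_at_top[of 4]
  proof eventually_elim
    case (elim n)
    define x where "x = real n"
    have x: "x \<ge> 4" using elim by (simp add: x_def)
    have "(1 / of_nat n ^ 3 - 1 / (of_nat n * (of_nat n - 1) * (of_nat n - 2)) :: complex)
        = of_real (1 / x ^ 3 - 1 / (x * (x - 1) * (x - 2)))" by (simp add: x_def)
    also have "1 / x ^ 3 - 1 / (x * (x - 1) * (x - 2)) = - ((3 * x - 2) / (x ^ 3 * ((x - 1) * (x - 2))))"
      using x by (simp add: divide_simps) (simp add: algebra_simps power3_eq_cube)
    also have "norm (of_real (- ((3 * x - 2) / (x ^ 3 * ((x - 1) * (x - 2))))) :: complex)
        = (3 * x - 2) / (x ^ 3 * ((x - 1) * (x - 2)))"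
      using x unfolding norm_of_real by (simp add: abs_mult)
    also have "\<dots> \<le> (3 * x) / (x ^ 3 * (x ^ 2 / 4))"
    proof (intro frac_le mult_left_mono)
      \<comment> \<open>valid from \<open>x = 4\<close> on; this is the source of the constant \<open>12 = 3 * 4\<close>\<close>
      have "x / 2 * (x / 2) \<le> (x - 1) * (x - 2)" using x by (intro mult_mono) auto
      thus "x\<^sup>2 / 4 \<le> (x - 1) * (x - 2)" by (simp add: power2_eq_square)
    qed (use x in auto)
    also have "\<dots> = 12 * (1 / x ^ 4)"
      using x by (simp add: field_simps power_numeral_reduce)
    finally show ?case by (simp add: x_def norm_divide norm_power)
  qed
qed

text \<open>
  The inverse factorial expansion is inserted and the order of summation exchanged.  For the
  dominating sequence, the inner absolute sums at \<open>k\<close> are compared with those at one fixed \<open>k0\<close> with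
  \<open>Re (\<sigma> + k0) > 0\<close>, leaving the factor \<open>1/\<Gamma>(\<sigma> + k)\<close> for the absolute convergence in \<open>k\<close>.
\<close>
lemma hypergeom_sum:
  assumes p: "p \<ge> 1"
    and a: "\<And>j. j \<in> {1..p + 1} \<Longrightarrow> a j \<notin> \<int>\<^sub>\<le>\<^sub>0"
    and pos: "\<And>j. j \<in> {3..p + 1} \<Longrightarrow> Re (a j) > 0"
    and s: "(\<Sum>j=1..p. b j) - (\<Sum>j=1..p + 1. a j) = 2"
  defines "c \<equiv> \<lambda>k. pochhammer 2 k / (pochhammer (a 1 + 2) k * pochhammer (a 2 + 2) k) * A_coeff p a b k"
  shows "summable c"
    and "hypergeom_term p a b sums (1 / (pochhammer (a 1) 2 * pochhammer (a 2) 2) * (\<Sum>k. c k))"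
proof -
  obtain n where n: "p = Suc n" using p by (cases p) auto
  have na: "a 1 \<notin> \<int>\<^sub>\<le>\<^sub>0" "a 2 \<notin> \<int>\<^sub>\<le>\<^sub>0" using a[of 1] a[of 2] p by auto
  have poch: "pochhammer z k \<noteq> 0" if "z \<notin> \<int>\<^sub>\<le>\<^sub>0" for z :: complex and k
    using that by (auto dest: pochhammer_eq_0_imp_nonpos_Int)
  have split12: "prod f {1..p+1} = f 1 * f 2 * prod f {3..p+1}" "sum f {1..p+1} = f 1 + f 2 + sum f {3..p+1}"
    for f :: "nat \<Rightarrow> complex"
  proof -
    have "{1..p+1} = insert 1 (insert 2 {3..p+1})" using p by auto
    thus "prod f {1..p+1} = f 1 * f 2 * prod f {3..p+1}" "sum f {1..p+1} = f 1 + f 2 + sum f {3..p+1}"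
      by (simp_all add: mult_ac add_ac)
  qed
  define \<sigma> where "\<sigma> = excess p a b"
  have \<sigma>: "\<sigma> = a 1 + a 2 + 2" using s unfolding split12 by (simp add: \<sigma>_def excess_def algebra_simps)
  define A where "A = A_coeff p a b"
  define K where "K = Gamma (a 1) * Gamma (a 2)"
  define f where "f k l = A k * K * gauss_term (a 1) (a 2) (\<sigma> + of_nat k) l" for k l
  have ser: "summable (\<lambda>k. norm (A k * rGamma (\<sigma> + of_nat l + of_nat k))) \<and>
     (\<lambda>k. A k * rGamma (\<sigma> + of_nat l + of_nat k)) sums
       ((\<Prod>j=3..p + 1. Gamma (a j + of_nat l)) * (\<Prod>j=1..p. rGamma (b j + of_nat l)))" for l
    unfolding A_def \<sigma>_def n by (rule gamma_quotient_inverse_factorial_series) (use pos n in auto)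
  have re: "Re (\<sigma> + of_nat k - a 1 - a 2) > 0" for k by (simp add: \<sigma>)
  note sg = summable_norm_gauss_term[OF re]
  have rows: "summable (\<lambda>l. norm (f k l))" for k
    unfolding f_def norm_mult[of "A k * K"] by (intro summable_mult sg)
  obtain k0 :: nat where k0: "real k0 > - Re \<sigma>" using reals_Archimedean2 by blast
  define M where "M = norm K * norm (Gamma (\<sigma> + of_nat k0)) * (\<Sum>l. norm (gauss_term (a 1) (a 2) (\<sigma> + of_nat k0) l))"
  have bound: "eventually (\<lambda>k. (\<Sum>l. norm (f k l)) \<le> M * norm (A k * rGamma (\<sigma> + of_nat k))) sequentially"
    using eventually_ge_at_top[of k0]
  proof eventually_elim
    case (elim k)
    then obtain m where m: "k = k0 + m" using le_Suc_ex by blast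
    have c: "Re (\<sigma> + of_nat k0) > 0" using k0 by simp
    have eq: "\<sigma> + of_nat k = \<sigma> + of_nat k0 + of_nat m" by (simp add: m)
    define D where "D = norm (A k) * norm K * (norm (rGamma (\<sigma> + of_nat k)) * norm (Gamma (\<sigma> + of_nat k0)))"
    have "norm (f k l) \<le> D * norm (gauss_term (a 1) (a 2) (\<sigma> + of_nat k0) l)" for l
      using norm_gauss_term_shift_le[OF c, of "a 1" "a 2" m l, folded eq]
      unfolding f_def D_def norm_mult mult.assoc by (intro mult_left_mono) auto
    hence "(\<Sum>l. norm (f k l)) \<le> (\<Sum>l. D * norm (gauss_term (a 1) (a 2) (\<sigma> + of_nat k0) l))"
      by (intro suminf_le rows summable_mult sg)
    also have "\<dots> = D * (\<Sum>l. norm (gauss_term (a 1) (a 2) (\<sigma> + of_nat k0) l))"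
      by (intro suminf_mult sg)
    also have "\<dots> = M * norm (A k * rGamma (\<sigma> + of_nat k))"
      by (simp add: D_def M_def norm_mult mult_ac)
    finally show ?case .
  qed
  have w: "summable (\<lambda>k. M * norm (A k * rGamma (\<sigma> + of_nat k)))"
    using ser[of 0] by (intro summable_mult) simp
  note DS = double_series(1,2)[OF rows bound w]
  define P where "P = 1 / (pochhammer (a 1) 2 * pochhammer (a 2) 2)"
  have "P \<noteq> 0" using poch na by (simp add: P_def)
  have row: "(\<Sum>l. f k l) = P * c k" for k
  proof -
    have G: "Gamma z * rGamma (z + 2 + of_nat k) = 1 / (pochhammer z 2 * pochhammer (z + 2) k)"
      if z: "z \<notin> \<int>\<^sub>\<le>\<^sub>0" for z :: complex
    proof -
      have "z + 2 \<notin> \<int>\<^sub>\<le>\<^sub>0"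
      proof
        assume "z + 2 \<in> \<int>\<^sub>\<le>\<^sub>0"
        then obtain i where "z + 2 = - of_nat i" by (elim nonpos_Ints_cases')
        hence "z = - of_nat (i + 2)" by (simp add: algebra_simps eq_neg_iff_add_eq_0)
        with z show False using minus_of_nat_in_nonpos_Ints by blast
      qed
      hence "pochhammer (z + 2) k \<noteq> 0" using poch by simp
      moreover have "rGamma z = pochhammer z 2 * (pochhammer (z + 2) k * rGamma (z + 2 + of_nat k))"
        using pochhammer_rGamma[of z 2] pochhammer_rGamma[of "z + 2" k] by simp
      moreover have "Gamma z * rGamma z = 1" using z by (simp add: rGamma_inverse_Gamma Gamma_eq_zero_iff)
      ultimately show ?thesis using poch[OF z, of 2] by (simp add: field_simps)
    qed
    have "(2 :: complex) \<notin> \<int>\<^sub>\<le>\<^sub>0" by (rule Re_pos_imp_notin_nonpos_Ints) simp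
    hence G2: "Gamma (2 + of_nat k :: complex) = pochhammer 2 k"
      using pochhammer_Gamma[of "2 :: complex" k] Gamma_fact[of 1, where 'a = complex] by simp
    have "gauss_term (a 1) (a 2) (\<sigma> + of_nat k) sums
        (Gamma (2 + of_nat k) * rGamma (a 2 + 2 + of_nat k) * rGamma (a 1 + 2 + of_nat k))"
      using gauss_summation[OF re, of k] by (simp add: \<sigma> algebra_simps)
    from sums_mult[OF this, of "A k * K"]
    have "(\<Sum>l. f k l) = A k * K * (Gamma (2 + of_nat k) * rGamma (a 2 + 2 + of_nat k) * rGamma (a 1 + 2 + of_nat k))"
      by (simp add: f_def[abs_def] sums_iff)
    also have "\<dots> = A k * pochhammer 2 k * (Gamma (a 1) * rGamma (a 1 + 2 + of_nat k)) * (Gamma (a 2) * rGamma (a 2 + 2 + of_nat k))"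
      unfolding K_def G2 by (simp only: mult_ac)
    also have "\<dots> = P * c k" unfolding G[OF na(1)] G[OF na(2)] by (simp add: P_def c_def A_def mult_ac)
    finally show ?thesis .
  qed
  have col: "(\<Sum>k. f k l) = hypergeom_term p a b l" for l
  proof -
    have "f k l = (K * pochhammer (a 1) l * pochhammer (a 2) l / fact l) * (A k * rGamma (\<sigma> + of_nat l + of_nat k))" for k
      by (simp add: f_def gauss_term_def add_ac)
    hence "(\<Sum>k. f k l) = (K * pochhammer (a 1) l * pochhammer (a 2) l / fact l) * ((\<Prod>j=3..p + 1. Gamma (a j + of_nat l)) * (\<Prod>j=1..p. rGamma (b j + of_nat l)))"
      using sums_mult[OF conjunct2[OF ser], of "K * pochhammer (a 1) l * pochhammer (a 2) l / fact l" l]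
      by (simp add: sums_iff)
    moreover have "K * pochhammer (a 1) l * pochhammer (a 2) l = Gamma (a 1 + of_nat l) * Gamma (a 2 + of_nat l)"
      using na by (simp add: K_def pochhammer_Gamma Gamma_eq_zero_iff)
    moreover have "Gamma (1 + of_nat l) = (fact l :: complex)" using Gamma_fact[of l, where 'a = complex] by simp
    ultimately show ?thesis unfolding hypergeom_term_def split12 by simp
  qed
  show c: "summable c" using DS(1) \<open>P \<noteq> 0\<close> unfolding row by (simp add: summable_cmult_iff)
  have "hypergeom_term p a b sums (\<Sum>k. P * c k)" using DS(2) unfolding row col .
  thus "hypergeom_term p a b sums (1 / (pochhammer (a 1) 2 * pochhammer (a 2) 2) * (\<Sum>k. c k))"
    unfolding P_def[symmetric] suminf_mult[OF c] .
qed

theorem theorem6: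
  fixes p :: nat and a b :: "nat \<Rightarrow> complex"
  assumes "p \<ge> 1"
    and "\<And>j. j \<in> {1..p + 1} \<Longrightarrow> a j \<notin> \<int>\<^sub>\<le>\<^sub>0"
    and "\<And>j. j \<in> {3..p + 1} \<Longrightarrow> Re (a j) > 0"
    and "(\<Sum>j=1..p. b j) - (\<Sum>j=1..p + 1. a j) = 2"
  shows "summable (\<lambda>k. pochhammer 2 k / (pochhammer (a 1 + 2) k * pochhammer (a 2 + 2) k)
                        * A_coeff p a b k)
    \<and> (\<lambda>m::nat.
         (\<Sum>l<m. (\<Prod>j=1..p + 1. Gamma (a j + of_nat l)) * (\<Prod>j=1..p. rGamma (b j + of_nat l))
                  / Gamma (1 + of_nat l))
         - (1 / (pochhammer (a 1) 2 * pochhammer (a 2) 2)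
              * (\<Sum>k. pochhammer 2 k / (pochhammer (a 1 + 2) k * pochhammer (a 2 + 2) k)
                        * A_coeff p a b k)
            - 1 / 2 * inverse ((of_nat m - 1) * (of_nat m - 2))))
      \<in> O(\<lambda>m. 1 / of_nat m ^ 3)"
proof -
  define c where "c k = pochhammer 2 k / (pochhammer (a 1 + 2) k * pochhammer (a 2 + 2) k) * A_coeff p a b k" for k
  define S where "S = 1 / (pochhammer (a 1) 2 * pochhammer (a 2) 2) * (\<Sum>k. c k)"
  define t where "t = hypergeom_term p a b"
  define D where "D m = (\<Sum>l<m. t l) - (S - 1 / 2 * inverse ((of_nat m - 1) * (of_nat m - 2)))" for m :: nat
  have sums: "summable c" "t sums S"
    using hypergeom_sum[OF assms] by (simp_all add: c_def[abs_def] S_def t_def)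
  have "(\<lambda>m. 1 / 2 * inverse ((of_nat m - 1) * (of_nat m - 2)) :: complex) \<longlonglongrightarrow> 0"
  proof -
    have "(\<lambda>m. 1 / 2 * inverse ((real m - 1) * (real m - 2))) \<longlonglongrightarrow> 0" by real_asymp
    from tendsto_of_real[OF this, where 'a = complex] show ?thesis by simp
  qed
  hence "D \<longlonglongrightarrow> S - (S - 0)"
    using sums(2) unfolding D_def sums_def by (intro tendsto_intros)
  hence "D \<longlonglongrightarrow> 0" by simp
  moreover have "(\<lambda>m. D (Suc m) - D m) \<in> O(\<lambda>m. 1 / of_nat m ^ Suc 3)"
  proof -
    have "eventually (\<lambda>m. D (Suc m) - D m = (t m - 1 / of_nat m ^ 3) +
        (1 / of_nat m ^ 3 - 1 / (of_nat m * (of_nat m - 1) * (of_nat m - 2)))) sequentially"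
      using eventually_ge_at_top[of 3]
    proof eventually_elim
      case (elim m)
      define x where "x = (of_nat m :: complex)"
      have "x \<noteq> of_nat 0" "x \<noteq> of_nat 1" "x \<noteq> of_nat 2"
        using elim unfolding x_def of_nat_eq_iff by auto
      hence nz: "x \<noteq> 0" "x - 1 \<noteq> 0" "x - 2 \<noteq> 0" by auto
      have S: "of_nat (Suc m) - 1 = x" "of_nat (Suc m) - 2 = x - 1" by (simp_all add: x_def)
      have "D (Suc m) - D m = t m + (1 / 2 * inverse (x * (x - 1)) - 1 / 2 * inverse ((x - 1) * (x - 2)))"
        unfolding D_def S x_def[symmetric] by simp
      also have "1 / 2 * inverse (x * (x - 1)) - 1 / 2 * inverse ((x - 1) * (x - 2)) = - (1 / (x * (x - 1) * (x - 2)))"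
        using nz by (simp add: divide_simps)
      finally show ?case by (simp add: x_def)
    qed
    hence "(\<lambda>m. D (Suc m) - D m) \<in> O(\<lambda>m. 1 / of_nat m ^ 4) \<longleftrightarrow>
      (\<lambda>m. (t m - 1 / of_nat m ^ 3) +
        (1 / of_nat m ^ 3 - 1 / (of_nat m * (of_nat m - 1) * (of_nat m - 2)))) \<in> O(\<lambda>m. 1 / of_nat m ^ 4)"
      by (rule landau_o.big.in_cong)
    moreover have "(\<lambda>m. (t m - 1 / of_nat m ^ 3) +
        (1 / of_nat m ^ 3 - 1 / (of_nat m * (of_nat m - 1) * (of_nat m - 2)))) \<in> O(\<lambda>m. 1 / of_nat m ^ 4)"
      unfolding t_def
      by (intro sum_in_bigo(1) hypergeom_term_asymp[OF assms(4)] telescoping_correction_bigo)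
    ultimately show ?thesis by (simp add: eval_nat_numeral)
  qed
  ultimately have "(\<lambda>m. D m - 0) \<in> O(\<lambda>m. 1 / of_nat m ^ 3)"
    by (intro bigo_of_increments) auto
  thus ?thesis using sums(1)
    by (simp add: D_def[abs_def] S_def c_def[abs_def] t_def hypergeom_term_def)
qed

end
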